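(* Let $A$ be a C*-algebra that is anniseparable and orthoseparable. Then for all $B,C\in[A]^\perp$ there exists a central element $D$ of the ortholattice $[A]^\perp$ such that $$B\cap D\precsim C\cap D\qquad\text{and}\qquad C\cap D^\perp\precsim B\cap D^\perp .$$
   Context: For $a,b\in A$ write $a\perp b$ if $ab=0=ab^*$, and for $S\subseteq A$ put $S^\perp=\{b\in A:s\perp b\text{ for all }s\in S\}$. An annihilator of $A$ is a set of the form $S^\perp$, $S\subseteq A$; $[A]^\perp$ is the set of annihilators. Ordered by inclusion, it is a complete ortholattice with infima given by intersection, $\bigvee\mathcal B=(\bigcup\mathcal B)^{\perp\perp}$ and orthocomplementation $B\mapsto B^\perp$. In an ortholattice, $s,t$ commute if both distributive laws $p\wedge(q\vee r)=(p\wedge q)\vee(p\wedge r)$ and $p\vee(q\wedge r)=(p\vee q)\wedge(p\vee r)$ hold for all $p,q,r\in\{s,s^\perp,t,t^\perp\}$; an element is central if it commutes with every element. $A$ is anniseparable if every $B\in[A]^\perp$ is of the form $S^\perp$ for some countable $S\subseteq A$. $A$ is orthoseparable if every pairwise orthogonal subset of $A_+$ (the positive elements) is countable. Annihilators $B,C$ are equivalent, $B\sim C$, if there is $a\in A$ with $\{a\}^{\perp\perp}=B$ and $\{a^*\}^{\perp\perp}=C$; and $B\precsim C$ if $B\sim E\subseteq C$ for some $E\in[A]^\perp$. *)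

theory Defs
  imports Complex_Main "HOL-Library.Countable_Set"
begin

text \<open>
  C*-algebras, as a type class. No unit is assumed, and the zero algebra is allowed.
  The inherited class \<open>real_normed_algebra\<close> supplies the ring structure and a submultiplicative
  norm, \<open>banach\<close> supplies completeness; \<open>scaleR_eq_scaleC\<close> makes the inherited real scalar
  multiplication the restriction of the complex one.
\<close>

class cstar_algebra = real_normed_algebra + banach +
  fixes scaleC :: "complex \<Rightarrow> 'a \<Rightarrow> 'a" (infixr "*\<^sub>C" 75)
    and star :: "'a \<Rightarrow> 'a"
  assumes scaleC_add_right: "c *\<^sub>C (x + y) = c *\<^sub>C x + c *\<^sub>C y"
    and scaleC_add_left: "(c + d) *\<^sub>C x = c *\<^sub>C x + d *\<^sub>C x"
    and scaleC_scaleC: "c *\<^sub>C d *\<^sub>C x = (c * d) *\<^sub>C x"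
    and scaleR_eq_scaleC: "r *\<^sub>R x = complex_of_real r *\<^sub>C x"
    and mult_scaleC_left: "(c *\<^sub>C x) * y = c *\<^sub>C (x * y)"
    and mult_scaleC_right: "x * (c *\<^sub>C y) = c *\<^sub>C (x * y)"
    and norm_scaleC: "norm (c *\<^sub>C x) = cmod c * norm x"
    and star_add: "star (x + y) = star x + star y"
    and star_scaleC: "star (c *\<^sub>C x) = cnj c *\<^sub>C star x"
    and star_mult: "star (x * y) = star y * star x"
    and star_star: "star (star x) = x"
    and norm_star_mult_self: "norm (star x * x) = (norm x)\<^sup>2"

definition positive_elements :: "'a::cstar_algebra set" where
  "positive_elements = {star x * x | x. True}"

text \<open>This relation is not symmetric in general; it is symmetric on self-adjoint elements.\<close>

definition perp :: "'a::cstar_algebra \<Rightarrow> 'a \<Rightarrow> bool" where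
  "perp a b \<longleftrightarrow> a * b = 0 \<and> a * star b = 0"

definition ann :: "'a::cstar_algebra set \<Rightarrow> 'a set" where
  "ann S = {b. \<forall>s\<in>S. perp s b}"

definition annihilators :: "'a::cstar_algebra set set" where
  "annihilators = range ann"

definition ann_join :: "'a::cstar_algebra set \<Rightarrow> 'a set \<Rightarrow> 'a set" where
  "ann_join B C = ann (ann (B \<union> C))"

text \<open>
  The ortholattice of annihilators has order \<open>\<subseteq>\<close>, meet \<open>\<inter>\<close>, join \<^const>\<open>ann_join\<close> and
  orthocomplement \<^const>\<open>ann\<close>; the lemmas below verify this.
\<close>

lemma star_zero: "star (0::'a::cstar_algebra) = 0"
  using star_add[of "0::'a" 0] by simp

lemma star_mult_eq_zero_iff: "star x * x = 0 \<longleftrightarrow> x = (0::'a::cstar_algebra)"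
  using norm_star_mult_self[of x] by fastforce

lemma star_mult_self_mult_eq_zero_iff:
  "star s * s * b = 0 \<longleftrightarrow> s * b = (0::'a::cstar_algebra)"
proof
  assume "star s * s * b = 0"
  then have "star (s * b) * (s * b) = 0"
    by (simp add: star_mult mult.assoc)
  then show "s * b = 0"
    by (simp add: star_mult_eq_zero_iff)
qed (simp add: mult.assoc)

lemma star_in_ann: "b \<in> ann S \<Longrightarrow> star b \<in> ann S"
  by (auto simp: ann_def perp_def star_star)

lemma ann_antimono: "S \<subseteq> T \<Longrightarrow> ann T \<subseteq> ann S"
  by (auto simp: ann_def)

lemma ann_in_annihilators: "ann S \<in> annihilators"
  by (simp add: annihilators_def)

lemma subset_ann_ann:
  assumes "\<And>s. s \<in> S \<Longrightarrow> star s \<in> S"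
  shows "S \<subseteq> ann (ann S)"
proof
  fix s assume s: "s \<in> S"
  show "s \<in> ann (ann S)"
    unfolding ann_def perp_def
  proof (intro CollectI ballI)
    fix u assume u: "u \<in> {b. \<forall>s\<in>S. s * b = 0 \<and> s * star b = 0}"
    then have "s * star u = 0" "star s * star u = 0"
      using s assms by auto
    then have "star (s * star u) = 0" "star (star s * star u) = 0"
      by (simp_all add: star_zero)
    then show "u * s = 0 \<and> u * star s = 0"
      by (simp add: star_mult star_star)
  qed
qed

lemma ann_ann_ann: "ann (ann (ann S)) = ann S"
proof
  show "ann S \<subseteq> ann (ann (ann S))"
    by (rule subset_ann_ann) (rule star_in_ann)
next
  define T where "T = (\<lambda>s. star s * s) ` S"
  have T: "ann T = ann S"
    by (auto simp: ann_def perp_def T_def star_mult_self_mult_eq_zero_iff)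
  have "star t \<in> T" if "t \<in> T" for t
    using that by (auto simp: T_def star_mult star_star)
  then have "T \<subseteq> ann (ann T)"
    by (rule subset_ann_ann)
  then have "ann (ann (ann T)) \<subseteq> ann T"
    by (rule ann_antimono)
  then show "ann (ann (ann S)) \<subseteq> ann S"
    by (simp add: T)
qed

lemma ann_ann: "B \<in> annihilators \<Longrightarrow> ann (ann B) = B"
  by (auto simp: annihilators_def ann_ann_ann)

lemma star_in_annihilator: "B \<in> annihilators \<Longrightarrow> b \<in> B \<Longrightarrow> star b \<in> B"
  by (auto simp: annihilators_def star_in_ann)

lemma Int_in_annihilators:
  assumes "B \<in> annihilators" "C \<in> annihilators"
  shows "B \<inter> C \<in> annihilators"
proof -
  from assms obtain S T where "B = ann S" "C = ann T"
    by (auto simp: annihilators_def)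
  then have "B \<inter> C = ann (S \<union> T)"
    by (auto simp: ann_def)
  then show ?thesis
    by (simp add: ann_in_annihilators)
qed

lemma ann_join_least:
  assumes "B \<in> annihilators" "C \<in> annihilators"
  shows "ann_join B C \<in> annihilators" "B \<subseteq> ann_join B C" "C \<subseteq> ann_join B C"
    and "E \<in> annihilators \<Longrightarrow> B \<subseteq> E \<Longrightarrow> C \<subseteq> E \<Longrightarrow> ann_join B C \<subseteq> E"
proof -
  show "ann_join B C \<in> annihilators"
    by (simp add: ann_join_def ann_in_annihilators)
  have "B \<union> C \<subseteq> ann_join B C"
    unfolding ann_join_def by (rule subset_ann_ann) (use assms star_in_annihilator in blast)
  then show "B \<subseteq> ann_join B C" "C \<subseteq> ann_join B C"
    by auto
  show "ann_join B C \<subseteq> E" if E: "E \<in> annihilators" "B \<subseteq> E" "C \<subseteq> E"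
  proof -
    have "ann (ann (B \<union> C)) \<subseteq> ann (ann E)"
      using E by (intro ann_antimono) auto
    then show ?thesis
      by (simp add: ann_join_def ann_ann E)
  qed
qed

lemma Int_ann: "B \<in> annihilators \<Longrightarrow> B \<inter> ann B = {0}"
proof
  show "B \<inter> ann B \<subseteq> {0}" if "B \<in> annihilators"
  proof
    fix b assume b: "b \<in> B \<inter> ann B"
    then have "star b * b = 0"
      using star_in_annihilator[OF that, of b] by (auto simp: ann_def perp_def)
    then show "b \<in> {0}"
      by (simp add: star_mult_eq_zero_iff)
  qed
qed (auto simp: annihilators_def ann_def perp_def star_zero)

definition ann_commute :: "'a::cstar_algebra set \<Rightarrow> 'a set \<Rightarrow> bool" where
  "ann_commute S T \<longleftrightarrow>
    (\<forall>P\<in>{S, ann S, T, ann T}. \<forall>Q\<in>{S, ann S, T, ann T}. \<forall>R\<in>{S, ann S, T, ann T}.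
      P \<inter> ann_join Q R = ann_join (P \<inter> Q) (P \<inter> R) \<and>
      ann_join P (Q \<inter> R) = ann_join P Q \<inter> ann_join P R)"

definition ann_central :: "'a::cstar_algebra set \<Rightarrow> bool" where
  "ann_central D \<longleftrightarrow> D \<in> annihilators \<and> (\<forall>E\<in>annihilators. ann_commute D E)"

text \<open>
  The next two properties concern the algebra itself, that is, the whole type \<^typ>\<open>'a\<close>, which is
  passed as a type argument.
\<close>

definition anniseparable :: "'a::cstar_algebra itself \<Rightarrow> bool" where
  "anniseparable _ \<longleftrightarrow>
    (\<forall>B\<in>(annihilators :: 'a set set). \<exists>S. countable S \<and> B = ann S)"

definition orthoseparable :: "'a::cstar_algebra itself \<Rightarrow> bool" where
  "orthoseparable _ \<longleftrightarrow>
    (\<forall>S\<subseteq>(positive_elements :: 'a set). pairwise perp S \<longrightarrow> countable S)"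

definition ann_equiv :: "'a::cstar_algebra set \<Rightarrow> 'a set \<Rightarrow> bool" (infix "\<sim>\<^sub>a" 50) where
  "B \<sim>\<^sub>a C \<longleftrightarrow> (\<exists>a. ann (ann {a}) = B \<and> ann (ann {star a}) = C)"

definition ann_subequiv :: "'a::cstar_algebra set \<Rightarrow> 'a set \<Rightarrow> bool" (infix "\<lesssim>\<^sub>a" 50) where
  "B \<lesssim>\<^sub>a C \<longleftrightarrow> (\<exists>E\<in>annihilators. B \<sim>\<^sub>a E \<and> E \<subseteq> C)"

end

theory Submission
  imports Defs "HOL-Analysis.Operator_Norm"
begin

text \<open>
  As for projections in a von Neumann algebra, start with a maximal family of nonzero elements \<open>a\<^sub>i\<close>
  whose right supports are orthogonal parts of \<open>B\<close> and whose left supports are orthogonal parts of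
  \<open>C\<close>. Orthoseparability makes the family countable, so a weighted sum \<open>a\<close> combines it into one element
  (\<open>exists_maximal_partial_equivalence\<close>). By maximality the remainders \<open>B' = B \<inter> {a}\<^sup>\<bottom>\<close> and
  \<open>C' = C \<inter> {a\<^sup>*}\<^sup>\<bottom>\<close> satisfy \<open>C' A B' = 0\<close>, so there is an annihilator \<open>D\<close> that is a two-sided ideal
  with \<open>C' \<subseteq> D\<close> and \<open>B' \<subseteq> D\<^sup>\<bottom>\<close> (\<open>annihilator_ideal_separation\<close>). Annihilators that are ideals
  are central (\<open>ann_central_ideal\<close>).

  The lattice of annihilators need not be orthomodular. Although no nonzero element of \<open>B \<inter> D\<close> is orthogonal to the
  right support of \<open>a\<close>, that support may therefore fail to exhaust \<open>B \<inter> D\<close>. The remedy is to multiply \<open>a\<close>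
  from the right by an element \<open>g\<close> with \<open>{g}\<^sup>\<bottom>\<^sup>\<bottom> = B \<inter> D\<close>: the product has right support exactly
  \<open>B \<inter> D\<close>, because \<open>a g x = 0\<close> puts \<open>(g x) (g x)\<^sup>*\<close> into \<open>B' \<inter> D = {0}\<close>, and its left support is still in
  \<open>C \<inter> D\<close> (\<open>subequiv_on_ideal\<close>). The same argument with \<open>a\<^sup>*\<close> works on \<open>D\<^sup>\<bottom>\<close>.

  Such a generator \<open>g\<close> exists by anniseparability: if \<open>f\<^sub>1, f\<^sub>2, \<dots>\<close> have annihilator \<open>(B \<inter> D)\<^sup>\<bottom>\<close>, then
  so has a weighted sum of the \<open>f\<^sub>n\<^sup>* f\<^sub>n\<close>, provided that no cancellation can occur in it. This is
  the one place where positivity enters, in the form \<open>\<parallel>y\<^sub>i\<parallel>\<^sup>2 \<le> \<parallel>\<Sum> y\<^sub>j\<^sup>* y\<^sub>j\<parallel>\<close>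
  (\<open>norm_le_norm_sum_star_mult_self\<close>). It is derived from the C*-identity without spectral theory: by square
  roots of elements near the unit, the bound \<open>\<parallel>a\<parallel>\<^sup>2 \<le> \<parallel>a\<^sup>2 + b\<^sup>2\<parallel>\<close> for commuting self-adjoint elements, and
  the passage to an algebra with unit.
\<close>

section \<open>Self-adjoint elements\<close>

lemma scaleC_minus_left: "(- c) *\<^sub>C x = - (c *\<^sub>C (x::'a::cstar_algebra))"
proof -
  have "(c + - c) *\<^sub>C x = 0"
    using scaleR_eq_scaleC[of 0 x] by simp
  then show ?thesis
    by (metis scaleC_add_left add_eq_0_iff)
qed

lemma scaleC_minus_right: "c *\<^sub>C (- x) = - (c *\<^sub>C (x::'a::cstar_algebra))"
proof -
  have "- x = (- 1) *\<^sub>C x"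
    using scaleR_eq_scaleC[of "- 1" x] by simp
  then have "c *\<^sub>C (- x) = (- c) *\<^sub>C x"
    using scaleC_scaleC[of c "- 1" x] by simp
  then show ?thesis
    by (simp add: scaleC_minus_left)
qed

lemma scaleC_diff_right: "c *\<^sub>C (x - y) = c *\<^sub>C x - c *\<^sub>C (y::'a::cstar_algebra)"
  using scaleC_add_right[of c x "- y"] by (simp add: scaleC_minus_right)

lemma star_scaleR: "star (r *\<^sub>R x) = r *\<^sub>R star (x::'a::cstar_algebra)"
  by (simp add: scaleR_eq_scaleC star_scaleC)

lemma star_minus: "star (- x) = - star (x::'a::cstar_algebra)"
  using star_scaleR[of "-1" x] by simp

lemma star_diff: "star (x - y) = star x - star (y::'a::cstar_algebra)"
  using star_add[of x "- y"] by (simp add: star_minus)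

lemma norm_star: "norm (star x) = norm (x::'a::cstar_algebra)"
proof -
  have le: "norm y \<le> norm (star y)" for y :: 'a
  proof (cases "y = 0")
    case False
    have "norm y * norm y \<le> norm (star y) * norm y"
      using norm_mult_ineq[of "star y" y] by (simp add: norm_star_mult_self power2_eq_square)
    then show ?thesis
      using False by simp
  qed simp
  show ?thesis
    using le[of x] le[of "star x"] by (simp add: star_star)
qed

lemma bounded_linear_star: "bounded_linear (star :: 'a::cstar_algebra \<Rightarrow> 'a)"
  by (rule bounded_linear_intro[where K = 1]) (simp_all add: star_add star_scaleR norm_star)

lemma norm_mult_star_self: "norm (x * star x) = (norm (x::'a::cstar_algebra))\<^sup>2"
  using norm_star_mult_self[of "star x"] by (simp add: star_star norm_star)

lemma norm_square_self_adjoint: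
  "star h = h \<Longrightarrow> norm (h * h) = (norm (h::'a::cstar_algebra))\<^sup>2"
  by (metis norm_star_mult_self)

text \<open>
  For commuting self-adjoint \<open>a\<close> and \<open>b\<close> the element \<open>u = a + i b\<close> satisfies
  \<open>u\<^sup>* u = a\<^sup>2 + b\<^sup>2\<close>, and \<open>a\<close> is the mean of \<open>u\<close> and \<open>u\<^sup>*\<close>, which have the same norm.
\<close>

lemma norm_le_norm_sum_squares:
  fixes a b :: "'a::cstar_algebra"
  assumes a: "star a = a" and b: "star b = b" and comm: "a * b = b * a"
  shows "(norm a)\<^sup>2 \<le> norm (a * a + b * b)"
proof -
  define u where "u = a + \<i> *\<^sub>C b"
  have su: "star u = a - \<i> *\<^sub>C b"
    by (simp add: u_def star_add star_scaleC a b scaleC_minus_left)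
  have "star u * u = a * a + b * b"
    unfolding su unfolding u_def
    by (simp add: algebra_simps mult_scaleC_left mult_scaleC_right scaleC_scaleC scaleC_minus_left
        scaleC_diff_right comm)
       (use scaleR_eq_scaleC[of 1 "b * b"] in simp)
  then have nu: "(norm u)\<^sup>2 = norm (a * a + b * b)"
    by (metis norm_star_mult_self)
  have "2 *\<^sub>R a = u + star u"
    unfolding su by (simp add: u_def scaleR_2)
  then have "2 * norm a \<le> norm u + norm (star u)"
    by (metis norm_triangle_ineq norm_scaleR abs_numeral)
  then have "norm a \<le> norm u"
    by (simp add: norm_star)
  then show ?thesis
    unfolding nu[symmetric] by (rule power_mono) simp
qed

section \<open>Positivity in unital C*-algebras\<close>

lemma star_one: "star 1 = (1::'a::{cstar_algebra,real_normed_algebra_1})"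
  by (metis star_star star_mult mult.right_neutral)

text \<open>
  The iteration \<open>w \<mapsto> (v + w\<^sup>2) / 2\<close> computes \<open>1 - sqrt (1 - v)\<close>. Its increments are dominated by
  those of the same iteration for the real number \<open>v = 1\<close>, which is increasing and bounded by 1.
\<close>

lemma square_root_of_near_one:
  fixes h :: "'a::{cstar_algebra,real_normed_algebra_1}"
  assumes h: "star h = h" and "norm (1 - h) \<le> 1"
  obtains k where "star k = k" "k * k = h" "norm (1 - k) \<le> 1"
    "\<And>z. z * h = h * z \<Longrightarrow> z * k = k * z"
proof -
  define v where "v = 1 - h"
  have v: "norm v \<le> 1" "star v = v"
    using assms by (simp_all add: v_def star_diff star_one)
  define w where "w = rec_nat 0 (\<lambda>_ u. (1/2) *\<^sub>R (v + u * u))"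
  have w_0: "w 0 = 0" and w_Suc: "w (Suc n) = (1/2) *\<^sub>R (v + w n * w n)" for n
    by (simp_all add: w_def)
  define r :: "nat \<Rightarrow> real" where "r = rec_nat 0 (\<lambda>_ u. (1 + u * u) / 2)"
  have r_0: "r 0 = 0" and r_Suc: "r (Suc n) = (1 + r n * r n) / 2" for n
    by (simp_all add: r_def)
  have r: "0 \<le> r n \<and> r n \<le> 1" for n
  proof (induction n)
    case (Suc n)
    then have "r n * r n \<le> 1 * 1"
      by (intro mult_mono) auto
    then show ?case
      by (simp add: r_Suc)
  qed (simp add: r_0)
  have w_star: "star (w n) = w n" for n
    by (induction n) (simp_all add: w_0 w_Suc star_zero star_scaleR star_add star_mult v)
  have w_comm: "z * w n = w n * z" if z: "z * v = v * z" for z n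
  proof (induction n)
    case (Suc n)
    have "z * (w n * w n) = w n * w n * z"
      by (metis Suc mult.assoc)
    then show ?case
      by (simp add: w_Suc distrib_left distrib_right z)
  qed (simp add: w_0)
  have w_le: "norm (w n) \<le> r n" for n
  proof (induction n)
    case (Suc n)
    have "norm (w n * w n) \<le> r n * r n"
      using norm_mult_ineq[of "w n" "w n"] mult_mono[OF Suc Suc] r[of n] by (meson norm_ge_zero order_trans)
    then have "norm (v + w n * w n) \<le> 1 + r n * r n"
      using v(1) norm_triangle_ineq[of v "w n * w n"] by linarith
    then show ?case
      by (simp add: w_Suc r_Suc)
  qed (simp add: w_0 r_0)
  have step: "norm (w (Suc n) - w n) \<le> r (Suc n) - r n" for n
  proof (induction n)
    case 0
    then show ?case
      using w_le[of "Suc 0"] by (simp add: w_0 r_0)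
  next
    case (Suc n)
    let ?d = "w (Suc n) - w n" and ?s = "w (Suc n) + w n"
    have "w n * w (Suc n) = w (Suc n) * w n"
      by (intro w_comm) (rule w_comm[symmetric], rule refl)
    then have "w (Suc (Suc n)) - w (Suc n) = (1/2) *\<^sub>R (?d * ?s)"
      unfolding w_Suc[of "Suc n"] by (subst (2) w_Suc) (simp add: algebra_simps)
    moreover have "norm (?d * ?s) \<le> (r (Suc n) - r n) * (r (Suc n) + r n)"
    proof (rule order_trans[OF norm_mult_ineq mult_mono])
      show "norm ?s \<le> r (Suc n) + r n"
        by (rule norm_triangle_le) (simp add: w_le add_mono)
      show "0 \<le> r (Suc n) - r n"
        using Suc norm_ge_zero order_trans by blast
    qed (use Suc in auto)
    moreover have "r (Suc (Suc n)) - r (Suc n) = (1/2) * ((r (Suc n) - r n) * (r (Suc n) + r n))"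
      by (simp add: r_Suc field_simps)
    ultimately show ?case
      by simp
  qed
  have gap: "norm (w (n + j) - w n) \<le> r (n + j) - r n" for n j
  proof (induction j)
    case (Suc j)
    have "norm (w (Suc (n + j)) - w n) \<le> norm (w (Suc (n + j)) - w (n + j)) + norm (w (n + j) - w n)"
      using norm_triangle_ineq[of "w (Suc (n + j)) - w (n + j)" "w (n + j) - w n"] by simp
    then show ?case
      using Suc step[of "n + j"] by simp
  qed simp
  have "incseq r"
    by (rule incseq_SucI) (metis step norm_ge_zero order_trans diff_ge_0_iff_ge)
  then have "Cauchy r"
    using incseq_convergent[of r 1] r by (metis LIMSEQ_imp_Cauchy)
  have "Cauchy w"
  proof (rule CauchyI)
    fix e :: real assume "e > 0"
    then obtain N where N: "\<And>m n. m \<ge> N \<Longrightarrow> n \<ge> N \<Longrightarrow> norm (r m - r n) < e"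
      using CauchyD[OF \<open>Cauchy r\<close>] by blast
    have less: "norm (w m - w n) < e" if "n \<ge> N" "m \<ge> n" for m n
      using gap[of n "m - n"] N[of m n] that by simp
    show "\<exists>N. \<forall>m\<ge>N. \<forall>n\<ge>N. norm (w m - w n) < e"
      by (metis less linorder_linear norm_minus_commute)
  qed
  then obtain l where l: "w \<longlonglongrightarrow> l"
    using Cauchy_convergent convergent_def by blast
  have "(\<lambda>n. (1/2) *\<^sub>R (v + w n * w n)) \<longlonglongrightarrow> (1/2) *\<^sub>R (v + l * l)"
    by (intro tendsto_intros l)
  then have "w \<longlonglongrightarrow> (1/2) *\<^sub>R (v + l * l)"
    by (subst filterlim_sequentially_Suc[symmetric]) (simp add: w_Suc)
  then have ll: "l = (1/2) *\<^sub>R (v + l * l)"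
    using l LIMSEQ_unique by blast
  have l2: "l + l = v + l * l"
    using arg_cong[OF ll, of "\<lambda>x. 2 *\<^sub>R x"] by (simp add: scaleR_2)
  show thesis
  proof
    have "(\<lambda>n. star (w n)) \<longlonglongrightarrow> star l"
      by (rule bounded_linear.tendsto[OF bounded_linear_star l])
    then have "star l = l"
      using l LIMSEQ_unique by (simp add: w_star) blast
    then show "star (1 - l) = 1 - l"
      by (simp add: star_diff star_one)
    have "(1 - l) * (1 - l) = 1 - (l + l) + l * l"
      by (simp add: algebra_simps)
    also have "\<dots> = h"
      by (simp add: l2 v_def)
    finally show "(1 - l) * (1 - l) = h" .
    have "norm (w n) \<le> 1" for n
      using w_le[of n] r[of n] by simp
    then have "norm l \<le> 1"
      by (intro LIMSEQ_le_const2[OF tendsto_norm[OF l]]) auto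
    then show "norm (1 - (1 - l)) \<le> 1"
      by simp
    show "z * (1 - l) = (1 - l) * z" if "z * h = h * z" for z
    proof -
      have zw: "z * w n = w n * z" for n
        by (rule w_comm) (simp add: v_def algebra_simps that)
      have "(\<lambda>n. z * w n) \<longlonglongrightarrow> z * l" "(\<lambda>n. z * w n) \<longlonglongrightarrow> l * z"
        using tendsto_mult_left[OF l, of z] tendsto_mult_right[OF l, of z] by (simp_all add: zw)
      then have "z * l = l * z"
        using LIMSEQ_unique by blast
      then show ?thesis
        by (simp add: algebra_simps)
    qed
  qed
qed

text \<open>
  The commutation clause is what makes the square roots below commute with one another.
\<close>

lemma square_root_exists:
  fixes h :: "'a::{cstar_algebra,real_normed_algebra_1}"
  assumes h: "star h = h" and ht: "norm (t *\<^sub>R 1 - h) \<le> t"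
  obtains k where "star k = k" "k * k = h" "norm (sqrt t *\<^sub>R 1 - k) \<le> sqrt t"
    "\<And>z. z * h = h * z \<Longrightarrow> z * k = k * z"
proof (cases "t = 0")
  case True
  with ht have "h = 0"
    by simp
  with True show ?thesis
    by (intro that[of 0]) (simp_all add: star_zero)
next
  case False
  then have t: "t > 0"
    using ht norm_ge_zero[of "t *\<^sub>R 1 - h"] by linarith
  define g where "g = (1/t) *\<^sub>R h"
  have hg: "h = t *\<^sub>R g"
    using t by (simp add: g_def)
  have "t * norm (1 - g) = norm (t *\<^sub>R 1 - h)"
    using t by (simp add: hg flip: scaleR_diff_right)
  then have "t * norm (1 - g) \<le> t * 1"
    using ht by simp
  then have "norm (1 - g) \<le> 1"
    using t by simp
  moreover have "star g = g"
    by (simp add: g_def star_scaleR h)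
  ultimately obtain k where k: "star k = k" "k * k = g" "norm (1 - k) \<le> 1"
    "\<And>z. z * g = g * z \<Longrightarrow> z * k = k * z"
    using square_root_of_near_one by blast
  show ?thesis
  proof (rule that[of "sqrt t *\<^sub>R k"])
    show "sqrt t *\<^sub>R k * sqrt t *\<^sub>R k = h"
      using t by (simp add: k hg)
    show "norm (sqrt t *\<^sub>R 1 - sqrt t *\<^sub>R k) \<le> sqrt t"
      using t k(3) by (simp flip: scaleR_diff_right)
    show "z * sqrt t *\<^sub>R k = sqrt t *\<^sub>R k * z" if "z * h = h * z" for z
      using k(4)[of z] that by (simp add: g_def)
  qed (simp add: star_scaleR k)
qed

text \<open>
  These are the positive elements. Squares of self-adjoint elements are chosen over the form
  \<open>x\<^sup>* x\<close> because closure under sums is then accessible by square roots; that every \<open>x\<^sup>* x\<close> is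
  such a square is the harder fact below.
\<close>

definition self_adjoint_square :: "'a::cstar_algebra \<Rightarrow> bool" where
  "self_adjoint_square h \<longleftrightarrow> (\<exists>k. star k = k \<and> h = k * k)"

lemma self_adjoint_squareI:
  fixes h :: "'a::{cstar_algebra,real_normed_algebra_1}"
  assumes "star h = h" and "norm (t *\<^sub>R 1 - h) \<le> t"
  shows "self_adjoint_square h"
  using square_root_exists[OF assms] by (metis self_adjoint_square_def)

lemma self_adjoint_square_mult_self: "star k = k \<Longrightarrow> self_adjoint_square (k * k)"
  by (auto simp: self_adjoint_square_def)

lemma star_self_adjoint_square: "self_adjoint_square h \<Longrightarrow> star h = h"
  by (auto simp: self_adjoint_square_def star_mult)

text \<open>
  The element \<open>t - k\<^sup>2\<close> has a square root \<open>c\<close>, because its distance from \<open>t\<close> is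
  \<open>\<parallel>k\<^sup>2\<parallel> \<le> t\<close>. This \<open>c\<close> commutes with \<open>k\<close>, so \<open>\<parallel>t - k\<^sup>2\<parallel> = \<parallel>c\<parallel>\<^sup>2 \<le> \<parallel>c\<^sup>2 + k\<^sup>2\<parallel> = t\<close>.
\<close>

lemma norm_diff_self_adjoint_square_le:
  fixes h :: "'a::{cstar_algebra,real_normed_algebra_1}"
  assumes "self_adjoint_square h" and ht: "norm h \<le> t"
  shows "norm (t *\<^sub>R 1 - h) \<le> t"
proof -
  obtain k where k: "star k = k" "h = k * k"
    using assms by (auto simp: self_adjoint_square_def)
  have "star (t *\<^sub>R 1 - h) = t *\<^sub>R 1 - h"
    by (simp add: star_diff star_scaleR star_one k star_mult)
  moreover have "norm (t *\<^sub>R 1 - (t *\<^sub>R 1 - h)) \<le> t"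
    using ht by simp
  ultimately obtain c where c: "star c = c" "c * c = t *\<^sub>R 1 - h"
    "\<And>z. z * (t *\<^sub>R 1 - h) = (t *\<^sub>R 1 - h) * z \<Longrightarrow> z * c = c * z"
    using square_root_exists by blast
  have "k * c = c * k"
    by (rule c(3)) (simp add: k algebra_simps)
  then have "(norm c)\<^sup>2 \<le> norm (c * c + k * k)"
    by (intro norm_le_norm_sum_squares c k) simp
  also have "\<dots> = t"
    using order_trans[OF norm_ge_zero ht] by (simp add: c k)
  finally show ?thesis
    using norm_square_self_adjoint[OF c(1)] by (simp add: c)
qed

lemma self_adjoint_square_add:
  fixes g h :: "'a::{cstar_algebra,real_normed_algebra_1}"
  assumes g: "self_adjoint_square g" and h: "self_adjoint_square h"
  shows "self_adjoint_square (g + h)"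
proof (rule self_adjoint_squareI)
  show "star (g + h) = g + h"
    using assms by (simp add: star_add star_self_adjoint_square)
  have "norm ((norm g *\<^sub>R 1 - g) + (norm h *\<^sub>R 1 - h)) \<le> norm g + norm h"
    by (intro norm_triangle_le add_mono norm_diff_self_adjoint_square_le assms order_refl)
  then show "norm ((norm g + norm h) *\<^sub>R 1 - (g + h)) \<le> norm g + norm h"
    by (simp add: algebra_simps)
qed

text \<open>
  With \<open>s = \<parallel>g + h\<parallel>\<close> the element \<open>s - g = (s - (g + h)) + h\<close> is a sum of squares, hence a square.
  Its square root commutes with that of \<open>g\<close>, so the bound for commuting squares applies to
  \<open>g + (s - g) = s\<close>.
\<close>

lemma norm_le_norm_add_self_adjoint_square:
  fixes g h :: "'a::{cstar_algebra,real_normed_algebra_1}"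
  assumes g: "self_adjoint_square g" and h: "self_adjoint_square h"
  shows "norm g \<le> norm (g + h)"
proof -
  define s where "s = norm (g + h)"
  have gh: "star (g + h) = g + h"
    using assms by (simp add: star_add star_self_adjoint_square)
  have "self_adjoint_square (s *\<^sub>R 1 - (g + h))"
    by (rule self_adjoint_squareI[where t = s])
       (simp only: star_diff star_scaleR star_one gh, simp add: s_def add.commute)
  from self_adjoint_square_add[OF this h] have sg: "self_adjoint_square (s *\<^sub>R 1 - g)"
    by simp
  obtain k where k: "star k = k" "g = k * k"
    using g by (auto simp: self_adjoint_square_def)
  obtain c where c: "star c = c" "c * c = s *\<^sub>R 1 - g"
    "\<And>z. z * (s *\<^sub>R 1 - g) = (s *\<^sub>R 1 - g) * z \<Longrightarrow> z * c = c * z"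
    by (rule square_root_exists[OF star_self_adjoint_square[OF sg]
          norm_diff_self_adjoint_square_le[OF sg order_refl]]) blast
  have "k * c = c * k"
    by (rule c(3)) (simp add: k algebra_simps)
  then have "(norm k)\<^sup>2 \<le> norm (k * k + c * c)"
    by (rule norm_le_norm_sum_squares[OF k(1) c(1)])
  also have "\<dots> = s"
    by (simp add: c k s_def)
  finally show ?thesis
    using norm_square_self_adjoint[OF k(1)] by (simp add: k s_def)
qed

text \<open>
  Put \<open>s = \<parallel>y\<parallel>\<^sup>2 = \<parallel>k\<^sup>2\<parallel>\<close> and \<open>p = y y\<^sup>*\<close>. Since \<open>2 (y\<^sup>* y + y y\<^sup>*)\<close> is a sum of two squares of
  self-adjoint elements and \<open>- y\<^sup>* y\<close> is a square, \<open>p\<close> is positive, whence \<open>\<parallel>s - p\<parallel> \<le> s\<close>. From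
  \<open>y (s + k\<^sup>2) = (s - p) y\<close> it follows that \<open>\<parallel>k (s + k\<^sup>2)\<parallel>\<^sup>2 = \<parallel>y (s + k\<^sup>2)\<parallel>\<^sup>2 \<le> s\<^sup>3\<close>. On the other
  hand \<open>(s + k\<^sup>2)\<^sup>2 = (s - k\<^sup>2)\<^sup>2 + 4 s k\<^sup>2\<close>, which makes the left hand side at least
  \<open>\<parallel>4 s k\<^sup>4\<parallel> = 4 s\<^sup>3\<close>. So \<open>s = 0\<close>.
\<close>

lemma eq_zero_if_star_mult_self_eq_minus_square:
  fixes y k :: "'a::{cstar_algebra,real_normed_algebra_1}"
  assumes k: "star k = k" and yk: "star y * y = - (k * k)"
  shows "y = 0"
proof -
  define s where "s = (norm y)\<^sup>2"
  define p where "p = y * star y"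
  define a where "a = y + star y"
  define b where "b = \<i> *\<^sub>C (star y - y)"
  have s0: "s \<ge> 0"
    by (simp add: s_def)
  have ks: "norm (k * k) = s"
    using norm_star_mult_self[of y] by (simp add: yk s_def)
  have ps: "norm p = s"
    by (simp add: p_def s_def norm_mult_star_self)
  have a: "star a = a"
    by (simp add: a_def star_add star_star add.commute)
  have b: "star b = b"
    by (simp add: b_def star_scaleC star_diff star_star scaleC_minus_left flip: scaleC_minus_right)
  have bb: "b * b = - ((star y - y) * (star y - y))"
    using scaleR_eq_scaleC[of 1 "(star y - y) * (star y - y)"]
    by (simp add: b_def mult_scaleC_left mult_scaleC_right scaleC_scaleC scaleC_minus_left)
  have "a * a + b * b = 2 *\<^sub>R p + 2 *\<^sub>R (star y * y)"
    unfolding bb by (simp add: a_def p_def algebra_simps scaleR_2)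
  then have "2 *\<^sub>R p = a * a + b * b + (k * k + k * k)"
    by (simp add: yk scaleR_2)
  moreover have "self_adjoint_square (a * a + b * b + (k * k + k * k))"
    by (intro self_adjoint_square_add self_adjoint_square_mult_self a b k)
  ultimately have "self_adjoint_square (2 *\<^sub>R p)"
    by simp
  then have "norm ((2 * s) *\<^sub>R 1 - 2 *\<^sub>R p) \<le> 2 * s"
    by (intro norm_diff_self_adjoint_square_le) (simp_all add: ps)
  moreover have "(2 * s) *\<^sub>R 1 - 2 *\<^sub>R p = 2 *\<^sub>R (s *\<^sub>R 1 - p)"
    by (simp add: scaleR_diff_right)
  ultimately have sp: "norm (s *\<^sub>R 1 - p) \<le> s"
    by simp
  define q where "q = s *\<^sub>R 1 + k * k"
  have q: "star q = q"
    by (simp add: q_def star_add star_scaleR star_one star_mult k)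
  have "y * (k * k) = - (p * y)"
    using yk by (metis minus_equation_iff mult.assoc mult_minus_right p_def)
  then have "y * q = (s *\<^sub>R 1 - p) * y"
    by (simp add: q_def algebra_simps)
  then have "norm (y * q) \<le> s * norm y"
    using norm_mult_ineq[of "s *\<^sub>R 1 - p" y] mult_right_mono[OF sp norm_ge_zero[of y]] by simp
  then have "(norm (y * q))\<^sup>2 \<le> (s * norm y)\<^sup>2"
    by (intro power_mono) simp_all
  then have up: "(norm (y * q))\<^sup>2 \<le> s ^ 3"
    by (simp add: power_mult_distrib s_def power2_eq_square power3_eq_cube mult_ac)
  have kq: "k * q = q * k"
    by (simp add: q_def algebra_simps)
  have "star (y * q) * (y * q) = - ((k * q) * (k * q))"
  proof -
    have "star (y * q) * (y * q) = q * (star y * y) * q"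
      by (simp add: star_mult q mult.assoc)
    also have "\<dots> = - ((q * k) * (k * q))"
      by (simp add: yk mult.assoc)
    finally show ?thesis
      by (simp add: kq)
  qed
  then have low: "(norm (y * q))\<^sup>2 = norm ((k * q) * (k * q))"
    by (metis norm_minus_cancel norm_star_mult_self)
  define c where "c = k * (s *\<^sub>R 1 - k * k)"
  define d where "d = (2 * sqrt s) *\<^sub>R (k * k)"
  have cd: "(k * q) * (k * q) = d * d + c * c"
    using s0 by (simp add: c_def d_def q_def algebra_simps)
      (simp flip: scaleR_add_left mult.assoc)
  have "(norm d)\<^sup>2 \<le> norm (d * d + c * c)"
    by (rule norm_le_norm_sum_squares)
       (simp_all add: c_def d_def star_mult star_diff star_scaleR star_one k left_diff_distrib
          right_diff_distrib scaleR_diff_right mult_ac)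
  moreover have "(norm d)\<^sup>2 = 4 * s ^ 3"
    using s0 by (simp add: d_def ks power_mult_distrib power2_eq_square power3_eq_cube)
  ultimately have "s ^ 3 \<le> 0"
    using up low unfolding cd by linarith
  then have "s = 0"
    using s0 by (metis zero_le_power order_antisym power_eq_0_iff)
  then show ?thesis
    by (simp add: s_def)
qed

text \<open>
  Let \<open>h = x\<^sup>* x\<close> and let \<open>m\<close> be its absolute value, the positive square root of \<open>h\<^sup>2\<close>. The element
  \<open>n = m - h\<close>, twice the negative part of \<open>h\<close>, satisfies \<open>h n = - m n\<close>, so
  \<open>(x n)\<^sup>* (x n) = - m n\<^sup>2\<close> is minus a square. By the previous lemma \<open>x n = 0\<close>; hence \<open>h n\<close> and \<open>m n\<close>
  vanish, \<open>n = 0\<close>, and \<open>h = m\<close> is a square.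
\<close>

lemma self_adjoint_square_star_mult_self:
  fixes x :: "'a::{cstar_algebra,real_normed_algebra_1}"
  shows "self_adjoint_square (star x * x)"
proof -
  define h where "h = star x * x"
  have h: "star h = h"
    by (simp add: h_def star_mult star_star)
  then have hh: "self_adjoint_square (h * h)"
    by (rule self_adjoint_square_mult_self)
  obtain m where m: "star m = m" "m * m = h * h"
    "norm (sqrt (norm (h * h)) *\<^sub>R 1 - m) \<le> sqrt (norm (h * h))"
    "\<And>z. z * (h * h) = (h * h) * z \<Longrightarrow> z * m = m * z"
    by (rule square_root_exists[OF star_self_adjoint_square[OF hh]
          norm_diff_self_adjoint_square_le[OF hh order_refl]]) blast
  obtain l where l: "star l = l" "l * l = m" "\<And>z. z * m = m * z \<Longrightarrow> z * l = l * z"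
    by (rule square_root_exists[OF m(1,3)]) blast
  have hm: "h * m = m * h"
    by (rule m(4)) (simp add: mult.assoc)
  define n where "n = m - h"
  have n: "star n = n"
    by (simp add: n_def star_diff m h)
  have hn: "h * n = - (m * n)"
    by (simp add: n_def algebra_simps hm m)
  have nl: "n * l = l * n"
    by (rule l(3)) (simp add: n_def algebra_simps hm)
  define k where "k = l * n"
  have k: "star k = k"
    by (simp add: k_def star_mult l n nl)
  have "star (x * n) * (x * n) = n * (h * n)"
    by (simp add: star_mult n h_def mult.assoc)
  also have "\<dots> = - (k * k)"
  proof -
    have "n * (m * n) = (n * l) * (l * n)"
      by (simp add: l(2)[symmetric] mult.assoc)
    then show ?thesis
      by (simp add: hn k_def nl)
  qed
  finally have "x * n = 0"
    by (rule eq_zero_if_star_mult_self_eq_minus_square[OF k])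
  then have "h * n = 0"
    by (simp add: h_def mult.assoc)
  moreover from this hn have "m * n = 0"
    by simp
  ultimately have "n * n = 0"
    using left_diff_distrib[of m h n] by (simp flip: n_def)
  then have "n = 0"
    using star_mult_eq_zero_iff[of n] n by simp
  then show ?thesis
    using self_adjoint_square_mult_self[OF l(1)] by (simp add: n_def l(2) h_def)
qed

lemma norm_le_norm_sum_star_mult_self_unital:
  fixes y :: "'b \<Rightarrow> 'a::{cstar_algebra,real_normed_algebra_1}"
  assumes "finite I" and "i \<in> I"
  shows "(norm (y i))\<^sup>2 \<le> norm (\<Sum>j\<in>I. star (y j) * y j)"
proof -
  have "self_adjoint_square (\<Sum>j\<in>J. star (y j) * y j)" if "finite J" for J
    using that
  proof (induction J rule: finite_induct)
    case empty
    show ?case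
      using star_zero by (auto simp: self_adjoint_square_def)
  qed (simp add: self_adjoint_square_add self_adjoint_square_star_mult_self)
  then have "norm (star (y i) * y i) \<le> norm (star (y i) * y i + (\<Sum>j\<in>I - {i}. star (y j) * y j))"
    using assms by (intro norm_le_norm_add_self_adjoint_square self_adjoint_square_star_mult_self) auto
  then show ?thesis
    using sum.remove[OF assms, of "\<lambda>j. star (y j) * y j"] by (simp add: norm_star_mult_self)
qed

section \<open>Adjoining a unit\<close>

text \<open>
  The pair \<open>(\<lambda>, a)\<close> stands for \<open>\<lambda> + a\<close>, which acts on the algebra by \<open>x \<mapsto> \<lambda> x + a x\<close>. If the
  algebra already has a unit \<open>e\<close>, the pair \<open>(1, - e)\<close> acts as zero; the maximum of the operator norm
  with \<open>\<bar>\<lambda>\<bar>\<close> is a C*-norm in either case.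
\<close>

datatype 'a unitization = Adjoin (scal: complex) (elt: 'a)

definition left_act :: "'a::cstar_algebra unitization \<Rightarrow> 'a \<Rightarrow> 'a" where
  "left_act u x = scal u *\<^sub>C x + elt u * x"

lemma scaleC_zero_right: "c *\<^sub>C 0 = (0::'a::cstar_algebra)"
  using scaleC_add_right[of c "0::'a" 0] by simp

lemma scaleC_one: "1 *\<^sub>C x = (x::'a::cstar_algebra)"
  using scaleR_eq_scaleC[of 1 x] by simp

lemma scaleC_zero_left: "0 *\<^sub>C x = (0::'a::cstar_algebra)"
  using scaleR_eq_scaleC[of 0 x] by simp

lemma bounded_linear_scaleC: "bounded_linear (\<lambda>x::'a::cstar_algebra. c *\<^sub>C x)"
  by (rule bounded_linear_intro[where K = "cmod c"])
     (simp_all add: scaleC_add_right scaleR_eq_scaleC scaleC_scaleC norm_scaleC mult.commute)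

lemma bounded_linear_left_act: "bounded_linear (left_act u)"
  unfolding left_act_def
  by (intro bounded_linear_add bounded_linear_scaleC bounded_linear_mult_right)

instantiation unitization :: (cstar_algebra) real_algebra_1
begin

definition "0 = Adjoin 0 0"
definition "1 = Adjoin 1 0"
definition "u + v = Adjoin (scal u + scal v) (elt u + elt v)"
definition "- u = Adjoin (- scal u) (- elt u)" for u :: "'a unitization"
definition "u - v = Adjoin (scal u - scal v) (elt u - elt v)"
definition "r *\<^sub>R u = Adjoin (r *\<^sub>R scal u) (r *\<^sub>R elt u)"
definition "u * v =
  Adjoin (scal u * scal v) (scal u *\<^sub>C elt v + scal v *\<^sub>C elt u + elt u * elt v)"

lemmas unitization_simps = zero_unitization_def one_unitization_def plus_unitization_def
  uminus_unitization_def minus_unitization_def scaleR_unitization_def times_unitization_def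

instance
proof
  fix u v w :: "'a unitization" and r s :: real
  show "u * v * w = u * (v * w)"
    by (simp add: unitization_simps algebra_simps scaleC_add_right scaleC_add_left scaleC_scaleC
        mult_scaleC_left mult_scaleC_right)
qed (auto simp: unitization_simps algebra_simps scaleC_add_right scaleC_add_left scaleC_scaleC
      mult_scaleC_left mult_scaleC_right scaleC_one scaleC_zero_left scaleC_zero_right
      scaleR_eq_scaleC scaleR_conv_of_real)

end

lemma left_act_add: "left_act (u + v) x = left_act u x + left_act v x"
  by (simp add: left_act_def unitization_simps scaleC_add_left algebra_simps)

lemma left_act_scaleR: "left_act (r *\<^sub>R u) x = r *\<^sub>R left_act u x"
  by (simp add: left_act_def unitization_simps scaleR_eq_scaleC scaleC_add_right scaleC_scaleC
      mult_scaleC_left scaleR_conv_of_real)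

lemma left_act_mult: "left_act (u * v) x = left_act u (left_act v x)"
  by (simp add: left_act_def unitization_simps scaleC_add_right scaleC_scaleC mult_scaleC_left
      mult_scaleC_right algebra_simps)

lemma left_act_one: "left_act 1 x = x"
  by (simp add: left_act_def unitization_simps scaleC_one)

instantiation unitization :: (cstar_algebra) real_normed_algebra_1
begin

definition "norm u = max (cmod (scal u)) (onorm (left_act u))"
definition "dist u v = norm (u - v)" for u v :: "'a unitization"
definition "sgn u = u /\<^sub>R norm u" for u :: "'a unitization"
definition [code del]:
  "(uniformity :: ('a unitization \<times> 'a unitization) filter) =
    (INF e\<in>{0<..}. principal {(x, y). dist x y < e})"
definition [code del]:
  "open U \<longleftrightarrow> (\<forall>x\<in>U. eventually (\<lambda>(x', y). x' = x \<longrightarrow> y \<in> U) uniformity)"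
    for U :: "'a unitization set"

instance
proof
  fix u v :: "'a unitization" and r :: real
  show "norm u = 0 \<longleftrightarrow> u = 0"
  proof
    assume "norm u = 0"
    then have "cmod (scal u) \<le> 0" "onorm (left_act u) \<le> 0"
      unfolding norm_unitization_def by (metis max.cobounded1, metis max.cobounded2)
    then have s: "scal u = 0" and "onorm (left_act u) = 0"
      using onorm_pos_le[OF bounded_linear_left_act[of u]] by auto
    then have "left_act u (star (elt u)) = 0"
      using onorm_eq_0[OF bounded_linear_left_act[of u]] by blast
    then have "elt u * star (elt u) = 0"
      by (simp add: left_act_def s scaleC_zero_left)
    then have "elt u = 0"
      using norm_mult_star_self[of "elt u"] by simp
    with s show "u = 0"
      by (simp add: unitization_simps unitization.expand)
  next
    assume "u = 0"
    then have "left_act u = (\<lambda>x. 0)"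
      by (simp add: fun_eq_iff left_act_def unitization_simps scaleC_zero_left)
    then show "norm u = 0"
      by (simp add: norm_unitization_def \<open>u = 0\<close> zero_unitization_def onorm_zero)
  qed
  have "onorm (left_act (u + v)) \<le> onorm (left_act u) + onorm (left_act v)"
    unfolding left_act_add[abs_def]
    by (intro onorm_triangle bounded_linear_left_act)
  moreover have "cmod (scal (u + v)) \<le> cmod (scal u) + cmod (scal v)"
    by (simp add: plus_unitization_def norm_triangle_ineq)
  ultimately show "norm (u + v) \<le> norm u + norm v"
    unfolding norm_unitization_def by linarith
  have "onorm (left_act (r *\<^sub>R u)) = \<bar>r\<bar> * onorm (left_act u)"
    unfolding left_act_scaleR[abs_def] by (rule onorm_scaleR[OF bounded_linear_left_act])
  then show "norm (r *\<^sub>R u) = \<bar>r\<bar> * norm u"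
    by (simp add: norm_unitization_def scaleR_unitization_def max_mult_distrib_left)
  have "onorm (left_act (u * v)) \<le> onorm (left_act u) * onorm (left_act v)"
    using onorm_compose[OF bounded_linear_left_act bounded_linear_left_act, of u v]
    by (simp add: left_act_mult[abs_def] comp_def)
  also have "\<dots> \<le> norm u * norm v"
    unfolding norm_unitization_def
    by (intro mult_mono) (auto simp: onorm_pos_le bounded_linear_left_act le_max_iff_disj)
  finally have "onorm (left_act (u * v)) \<le> norm u * norm v" .
  moreover have "cmod (scal (u * v)) \<le> norm u * norm v"
    unfolding norm_unitization_def times_unitization_def
    by (auto simp: norm_mult le_max_iff_disj intro!: mult_mono)
  ultimately show "norm (u * v) \<le> norm u * norm v"
    by (simp add: norm_unitization_def[of "u * v"])
  have "onorm (left_act (1 :: 'a unitization)) \<le> 1"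
    unfolding left_act_one[abs_def] by (rule onorm_id_le)
  then show "norm (1 :: 'a unitization) = 1"
    by (simp add: norm_unitization_def) (simp add: one_unitization_def)
qed (simp_all add: dist_unitization_def sgn_unitization_def uniformity_unitization_def
      open_unitization_def)

end

lemma norm_scal_le: "cmod (scal u) \<le> norm u"
  by (simp add: norm_unitization_def)

lemma norm_left_act_le: "norm (left_act u x) \<le> norm u * norm x"
  using onorm[OF bounded_linear_left_act, of u x]
    mult_right_mono[of "onorm (left_act u)" "norm u" "norm x"]
  by (simp add: norm_unitization_def)

lemma norm_unitization_leI:
  assumes "cmod (scal u) \<le> K" and "\<And>x. norm (left_act u x) \<le> K * norm x"
  shows "norm u \<le> K"
  unfolding norm_unitization_def
  using assms onorm_bound[OF order_trans[OF norm_ge_zero assms(1)] assms(2)] by simp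

lemma norm_Adjoin_0: "norm (Adjoin 0 a) = norm (a::'a::cstar_algebra)"
proof (rule antisym)
  show "norm (Adjoin 0 a) \<le> norm a"
    by (rule norm_unitization_leI) (simp_all add: left_act_def scaleC_zero_left norm_mult_ineq)
  have "norm (a * star a) \<le> norm (Adjoin 0 a) * norm (star a)"
    using norm_left_act_le[of "Adjoin 0 a" "star a"] by (simp add: left_act_def scaleC_zero_left)
  then show "norm a \<le> norm (Adjoin 0 a)"
    by (cases "a = 0") (auto simp: norm_mult_star_self norm_star power2_eq_square)
qed

lemma norm_Adjoin_le: "norm (Adjoin c a) \<le> cmod c + norm a"
proof -
  have "norm (Adjoin c 0 :: 'a unitization) \<le> cmod c"
    by (rule norm_unitization_leI) (simp_all add: left_act_def norm_scaleC)
  then show ?thesis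
    using norm_triangle_ineq[of "Adjoin c 0" "Adjoin 0 a"]
    by (simp add: plus_unitization_def norm_Adjoin_0)
qed

lemma norm_elt_le: "norm (elt u) \<le> 2 * norm u"
proof -
  have "norm (elt u) = norm (u + Adjoin (- scal u) 0)"
    by (simp add: plus_unitization_def norm_Adjoin_0)
  also have "\<dots> \<le> norm u + norm (Adjoin (- scal u) 0 :: 'a unitization)"
    by (rule norm_triangle_ineq)
  also have "\<dots> \<le> norm u + cmod (scal u)"
    using norm_Adjoin_le[of "- scal u" "0::'a"] by simp
  finally show ?thesis
    using norm_scal_le[of u] by simp
qed

instance unitization :: (cstar_algebra) banach
proof
  fix X :: "nat \<Rightarrow> 'a unitization"
  assume X: "Cauchy X"
  have lin: "bounded_linear (scal :: 'a unitization \<Rightarrow> complex)"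
    "bounded_linear (elt :: 'a unitization \<Rightarrow> 'a)"
    by (rule bounded_linear_intro[where K = 1], simp_all add: unitization_simps norm_scal_le)
       (rule bounded_linear_intro[where K = 2],
         simp_all add: unitization_simps norm_elt_le mult.commute[of _ 2])
  obtain c where c: "(\<lambda>n. scal (X n)) \<longlonglongrightarrow> c"
    using bounded_linear.Cauchy[OF lin(1) X] Cauchy_convergent convergent_def by blast
  obtain a where a: "(\<lambda>n. elt (X n)) \<longlonglongrightarrow> a"
    using bounded_linear.Cauchy[OF lin(2) X] Cauchy_convergent convergent_def by blast
  have "(\<lambda>n. cmod (scal (X n) - c) + norm (elt (X n) - a)) \<longlonglongrightarrow> 0"
    using tendsto_add[OF tendsto_norm_zero[OF LIM_zero[OF c]] tendsto_norm_zero[OF LIM_zero[OF a]]]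
    by simp
  then have "(\<lambda>n. X n - Adjoin c a) \<longlonglongrightarrow> 0"
    by (rule tendsto_0_le[where K = 1]) (simp add: minus_unitization_def norm_Adjoin_le)
  then show "convergent X"
    using LIM_zero_cancel convergent_def by blast
qed

instantiation unitization :: (cstar_algebra) cstar_algebra
begin

definition "c *\<^sub>C u = Adjoin (c * scal u) (c *\<^sub>C elt u)" for u :: "'a unitization"
definition "star u = Adjoin (cnj (scal u)) (star (elt u))" for u :: "'a unitization"

instance
proof
  fix c d :: complex and u v :: "'a unitization" and r :: real
  note defs = unitization_simps scaleC_unitization_def star_unitization_def
  show "c *\<^sub>C (u + v) = c *\<^sub>C u + c *\<^sub>C v" "(c + d) *\<^sub>C u = c *\<^sub>C u + d *\<^sub>C u"
    "c *\<^sub>C d *\<^sub>C u = (c * d) *\<^sub>C u" "c *\<^sub>C u * v = c *\<^sub>C (u * v)" "u * c *\<^sub>C v = c *\<^sub>C (u * v)"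
    by (simp_all add: defs algebra_simps scaleC_add_right scaleC_add_left scaleC_scaleC
        mult_scaleC_left mult_scaleC_right)
  show "r *\<^sub>R u = complex_of_real r *\<^sub>C u"
    by (simp add: defs scaleR_eq_scaleC scaleR_conv_of_real)
  show "star (u + v) = star u + star v" "star (c *\<^sub>C u) = cnj c *\<^sub>C star u"
    "star (u * v) = star v * star u" and ss: "star (star u) = u"
    by (simp_all add: defs star_add star_scaleC star_mult star_star add_ac)
  have le: "norm (c *\<^sub>C u) \<le> cmod c * norm u" for c and u :: "'a unitization"
  proof (rule norm_unitization_leI)
    show "cmod (scal (c *\<^sub>C u)) \<le> cmod c * norm u"
      by (simp add: scaleC_unitization_def norm_mult norm_scal_le mult_left_mono)
    show "norm (left_act (c *\<^sub>C u) x) \<le> cmod c * norm u * norm x" for x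
      using mult_left_mono[OF norm_left_act_le[of u x] norm_ge_zero[of c]]
      by (simp add: left_act_def scaleC_unitization_def mult_scaleC_left norm_scaleC mult.assoc
          flip: scaleC_scaleC scaleC_add_right)
  qed
  show "norm (c *\<^sub>C u) = cmod c * norm u"
  proof (cases "c = 0")
    case True
    then show ?thesis
      using le[of c u] by simp
  next
    case False
    then have "inverse c *\<^sub>C c *\<^sub>C u = u"
      by (simp add: scaleC_unitization_def scaleC_scaleC scaleC_one flip: mult.assoc)
    then have "norm u \<le> inverse (cmod c) * norm (c *\<^sub>C u)"
      using le[of "inverse c" "c *\<^sub>C u"] by (simp add: norm_inverse)
    then show ?thesis
      using le[of c u] False by (simp add: field_simps)
  qed
  have sq: "(norm u)\<^sup>2 \<le> norm (star u * u)" for u :: "'a unitization"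
  proof -
    let ?N = "norm (star u * u)"
    have "norm u \<le> sqrt ?N"
    proof (rule norm_unitization_leI)
      have "(cmod (scal u))\<^sup>2 = cmod (scal (star u * u))"
        by (simp add: defs norm_mult power2_eq_square)
      then show "cmod (scal u) \<le> sqrt ?N"
        using norm_scal_le[of "star u * u"] by (intro real_le_rsqrt) simp
      fix x
      have "star (left_act u x) * left_act u x = star x * left_act (star u * u) x"
        by (simp add: left_act_def defs star_add star_mult star_scaleC mult_scaleC_left
            mult_scaleC_right scaleC_add_right scaleC_add_left scaleC_scaleC algebra_simps)
      then have "(norm (left_act u x))\<^sup>2 \<le> norm x * (?N * norm x)"
        using norm_mult_ineq[of "star x" "left_act (star u * u) x"]
          mult_left_mono[OF norm_left_act_le[of "star u * u" x] norm_ge_zero[of x]]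
        by (simp add: norm_star flip: norm_star_mult_self)
      also have "\<dots> = (sqrt ?N * norm x)\<^sup>2"
        by (simp add: power_mult_distrib power2_eq_square)
      finally show "norm (left_act u x) \<le> sqrt ?N * norm x"
        by (rule power2_le_imp_le) simp
    qed
    then show ?thesis
      by (metis norm_ge_zero power_mono real_sqrt_pow2)
  qed
  have "norm u \<le> norm (star u)" for u :: "'a unitization"
  proof (cases "u = 0")
    case False
    have "norm u * norm u \<le> norm (star u) * norm u"
      using sq[of u] norm_mult_ineq[of "star u" u] by (simp add: power2_eq_square)
    then show ?thesis
      using False by simp
  qed simp
  from this[of u] this[of "star u"] have "norm (star u) = norm u"
    by (simp add: ss)
  then show "norm (star u * u) = (norm u)\<^sup>2"
    using sq[of u] norm_mult_ineq[of "star u" u] by (simp add: power2_eq_square)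
qed

end

lemma Adjoin_0_sum: "(\<Sum>j\<in>I. Adjoin 0 (y j)) = Adjoin 0 (\<Sum>j\<in>I. y j :: 'a::cstar_algebra)"
  by (induction I rule: infinite_finite_induct) (simp_all add: unitization_simps)

text \<open>
  The bound in the unitization restricts to the algebra because the embedding is isometric.
\<close>

lemma norm_le_norm_sum_star_mult_self:
  fixes y :: "'b \<Rightarrow> 'a::cstar_algebra"
  assumes "finite I" and "i \<in> I"
  shows "(norm (y i))\<^sup>2 \<le> norm (\<Sum>j\<in>I. star (y j) * y j)"
proof -
  have "star (Adjoin 0 a) * Adjoin 0 a = Adjoin 0 (star a * a)" for a :: 'a
    by (simp add: times_unitization_def star_unitization_def scaleC_zero_left)
  then show ?thesis
    using norm_le_norm_sum_star_mult_self_unital[OF assms, of "\<lambda>j. Adjoin 0 (y j)"]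
    by (simp add: Adjoin_0_sum norm_Adjoin_0)
qed

section \<open>Annihilators of single elements\<close>

lemma mult_star_mult_eq_zero_iff: "e * (star e * e) = 0 \<longleftrightarrow> e = (0::'a::cstar_algebra)"
proof
  assume "e * (star e * e) = 0"
  then have "star (star e * e) * (star e * e) = 0"
    by (simp add: star_mult star_star mult.assoc)
  then show "e = 0"
    by (simp add: star_mult_eq_zero_iff)
qed simp

lemma mult_star_eq_zero_iff: "e * star e = 0 \<longleftrightarrow> e = (0::'a::cstar_algebra)"
  using norm_mult_star_self[of e] by fastforce

lemma star_eq_zero_iff: "star x = 0 \<longleftrightarrow> x = (0::'a::cstar_algebra)"
  by (metis norm_star norm_eq_zero)

lemma mem_ann_iff:
  assumes "\<And>s. s \<in> S \<Longrightarrow> star s \<in> S"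
  shows "y \<in> ann S \<longleftrightarrow> (\<forall>s\<in>S. s * y = 0 \<and> y * s = 0)"
proof -
  have "y * star s = 0 \<longleftrightarrow> s * star y = 0" for s
    using star_eq_zero_iff[of "y * star s"] by (simp add: star_mult star_star)
  then have "y \<in> ann S \<longleftrightarrow> (\<forall>s\<in>S. s * y = 0 \<and> y * star s = 0)"
    by (simp add: ann_def perp_def)
  also have "\<dots> \<longleftrightarrow> (\<forall>s\<in>S. s * y = 0 \<and> y * s = 0)"
    using assms by (metis star_star)
  finally show ?thesis .
qed

lemma mem_ann_singleton_iff: "y \<in> ann {a} \<longleftrightarrow> a * y = 0 \<and> a * star y = 0"
  by (simp add: ann_def perp_def)

lemma ann_mult_eq_zero:
  assumes "B \<in> annihilators" and "b \<in> B" and "y \<in> ann B"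
  shows "b * y = 0" and "y * b = 0"
  using mem_ann_iff[OF star_in_annihilator[OF assms(1)], of y] assms(2,3) by blast+

lemma annihilator_memI:
  assumes "B \<in> annihilators" and "\<And>y. y \<in> ann B \<Longrightarrow> y * b = 0 \<and> b * y = 0"
  shows "b \<in> B"
proof -
  have "b \<in> ann (ann B)"
    by (subst mem_ann_iff) (use assms(2) star_in_ann in blast)+
  then show ?thesis
    by (simp add: ann_ann[OF assms(1)])
qed

lemma annihilator_hereditary:
  assumes "B \<in> annihilators" and "b \<in> B" and "c \<in> B"
  shows "b * w * c \<in> B"
proof (rule annihilator_memI[OF assms(1)])
  fix y assume "y \<in> ann B"
  then have yb: "y * b = 0" and cy: "c * y = 0"
    using ann_mult_eq_zero[OF assms(1)] assms(2,3) by auto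
  have "y * (b * w * c) = y * b * w * c"
    by (simp add: mult.assoc)
  then show "y * (b * w * c) = 0 \<and> b * w * c * y = 0"
    by (simp add: yb) (simp add: mult.assoc cy)
qed

lemma summable_positive_weights:
  fixes f :: "nat \<Rightarrow> 'a::banach"
  obtains c :: "nat \<Rightarrow> real" where "\<And>n. 0 < c n" "summable (\<lambda>n. c n *\<^sub>R f n)"
proof
  define c where "c n = (1/2) ^ n / (1 + norm (f n))" for n
  have pos: "0 < 1 + norm (f n)" for n
    using norm_ge_zero[of "f n"] by linarith
  then show "0 < c n" for n
    by (simp add: c_def)
  show "summable (\<lambda>n. c n *\<^sub>R f n)"
  proof (rule summable_comparison_test)
    have "norm (c n *\<^sub>R f n) \<le> (1/2) ^ n" for n
    proof -
      have "norm (c n *\<^sub>R f n) = (1/2) ^ n * (norm (f n) / (1 + norm (f n)))"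
        using pos[of n] by (simp add: c_def)
      also have "\<dots> \<le> (1/2) ^ n * 1"
        using pos[of n] by (intro mult_left_mono) simp_all
      finally show ?thesis
        by simp
    qed
    then show "\<exists>N. \<forall>n\<ge>N. norm (c n *\<^sub>R f n) \<le> (1/2) ^ n"
      by blast
    show "summable (\<lambda>n. (1/2 :: real) ^ n)"
      by simp
  qed
qed

text \<open>
  The element is a convergent sum \<open>g = \<Sum> c\<^sub>n f\<^sub>n\<^sup>* f\<^sub>n\<close> with positive weights: if \<open>g x = 0\<close>, then
  \<open>\<Sum> c\<^sub>n (f\<^sub>n x)\<^sup>* (f\<^sub>n x) = 0\<close>, and the norm of each term is bounded by the norms of the partial sums.
\<close>

lemma ann_range_eq_ann_singleton:
  fixes f :: "nat \<Rightarrow> 'a::cstar_algebra"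
  obtains g where "star g = g" "ann {g} = ann (range f)"
proof -
  obtain c where c: "\<And>n. 0 < c n" and sum: "summable (\<lambda>n. c n *\<^sub>R (star (f n) * f n))"
    by (rule summable_positive_weights[of "\<lambda>n. star (f n) * f n"]) (rule that)
  define g where "g = (\<Sum>n. c n *\<^sub>R (star (f n) * f n))"
  have g: "(\<lambda>n. c n *\<^sub>R (star (f n) * f n)) sums g"
    unfolding g_def by (rule summable_sums[OF sum])
  have "(\<lambda>n. c n *\<^sub>R (star (f n) * f n)) sums star g"
    using bounded_linear.sums[OF bounded_linear_star g] by (simp add: star_scaleR star_mult star_star)
  then have sg: "star g = g"
    using g sums_unique2 by blast
  have "g * x = 0 \<longleftrightarrow> (\<forall>n. f n * x = 0)" for x
  proof
    assume gx: "g * x = 0"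
    define y where "y n = sqrt (c n) *\<^sub>R (f n * x)" for n
    have "star (y n) * y n = star x * (c n *\<^sub>R (star (f n) * f n)) * x" for n
      using c[of n] by (simp add: y_def star_scaleR star_mult mult.assoc)
    moreover have "(\<lambda>n. star x * (c n *\<^sub>R (star (f n) * f n)) * x) sums (star x * g * x)"
      by (rule bounded_linear.sums[OF bounded_linear_mult_left
            bounded_linear.sums[OF bounded_linear_mult_right g]])
    moreover have "star x * g * x = 0"
      by (simp add: gx mult.assoc)
    ultimately have "(\<lambda>n. star (y n) * y n) sums 0"
      by (simp only:)
    then have lim: "(\<lambda>n. norm (\<Sum>j<n. star (y j) * y j)) \<longlonglongrightarrow> 0"
      unfolding sums_def by (rule tendsto_norm_zero)
    show "\<forall>n. f n * x = 0"
    proof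
      fix n
      have "\<forall>m\<ge>Suc n. (norm (y n))\<^sup>2 \<le> norm (\<Sum>j<m. star (y j) * y j)"
        by (intro allI impI norm_le_norm_sum_star_mult_self) simp_all
      then have "(norm (y n))\<^sup>2 \<le> 0"
        using LIMSEQ_le_const[OF lim] by blast
      then show "f n * x = 0"
        using c[of n] by (simp add: y_def)
    qed
  next
    assume "\<forall>n. f n * x = 0"
    then have "(\<lambda>n. 0) sums (g * x)"
      using bounded_linear.sums[OF bounded_linear_mult_left g, of x] by (simp add: mult.assoc)
    then show "g * x = 0"
      using sums_unique2 sums_zero by blast
  qed
  then have "ann {g} = ann (range f)"
    by (simp add: ann_def perp_def set_eq_iff) blast
  with sg show thesis
    by (rule that)
qed

lemma ann_eq_ann_singleton:
  fixes B :: "'a::cstar_algebra set"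
  assumes "anniseparable TYPE('a)" and "B \<in> annihilators"
  obtains g :: 'a where "star g = g" "ann {g} = ann B"
proof -
  obtain S :: "'a set" where S: "countable S" "ann B = ann S"
    using assms ann_in_annihilators by (metis anniseparable_def)
  have "range (from_nat_into (insert 0 S)) = insert 0 S"
    using S(1) by (intro range_from_nat_into) auto
  moreover have "ann (insert 0 S) = ann S"
    by (auto simp: ann_def perp_def)
  ultimately have "ann (range (from_nat_into (insert 0 S))) = ann B"
    by (simp add: S(2))
  then show thesis
    using ann_range_eq_ann_singleton[of "from_nat_into (insert 0 S)"] that by auto
qed

section \<open>Ideals are central\<close>

definition annihilator_ideal :: "'a::cstar_algebra set \<Rightarrow> bool" where
  "annihilator_ideal Z \<longleftrightarrow> Z \<in> annihilators \<and> (\<forall>z\<in>Z. \<forall>w. w * z \<in> Z \<and> z * w \<in> Z)"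

lemma annihilator_ideal_ann:
  assumes "annihilator_ideal Z"
  shows "annihilator_ideal (ann Z)"
  unfolding annihilator_ideal_def
proof (intro conjI ballI allI)
  have Z: "Z \<in> annihilators" and ideal: "\<And>z w. z \<in> Z \<Longrightarrow> w * z \<in> Z \<and> z * w \<in> Z"
    using assms by (auto simp: annihilator_ideal_def)
  have mem: "y \<in> ann Z \<longleftrightarrow> (\<forall>s\<in>Z. s * y = 0 \<and> y * s = 0)" for y
    by (rule mem_ann_iff) (rule star_in_annihilator[OF Z])
  fix y w assume y: "y \<in> ann Z"
  show "w * y \<in> ann Z"
    unfolding mem using y ideal by (metis mem mult.assoc mult_zero_right)
  show "y * w \<in> ann Z"
    unfolding mem using y ideal by (metis mem mult.assoc mult_zero_left)
qed (rule ann_in_annihilators)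

lemma ann_Un: "ann (S \<union> T) = ann S \<inter> ann T"
  by (auto simp: ann_def)

lemma ann_join_eq: "ann_join P Q = ann (ann P \<inter> ann Q)"
  by (simp add: ann_join_def ann_Un)

lemma ann_ann_join: "ann (ann_join P Q) = ann P \<inter> ann Q"
  unfolding ann_join_def ann_ann_ann by (rule ann_Un)

lemma ann_Int:
  "P \<in> annihilators \<Longrightarrow> Q \<in> annihilators \<Longrightarrow> ann (P \<inter> Q) = ann_join (ann P) (ann Q)"
  by (simp add: ann_join_eq ann_ann)

lemma ann_join_commute: "ann_join P Q = ann_join Q P"
  by (simp add: ann_join_def Un_commute)

text \<open>
  Let \<open>y\<close> annihilate \<open>Z \<inter> Q\<close> and \<open>Z \<inter> R\<close>. For \<open>q\<close> in \<open>Q\<close> or \<open>R\<close> and \<open>d \<in> Z\<close> the element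
  \<open>q d d\<^sup>* q\<^sup>*\<close> lies in \<open>Z \<inter> Q\<close> or \<open>Z \<inter> R\<close>, so \<open>y q d = 0\<close>. As \<open>Z\<close> is an ideal, \<open>d\<close> can change
  sides: \<open>d y q = 0\<close>. So \<open>(d y)\<^sup>* (d y)\<close> annihilates \<open>Q\<close> and \<open>R\<close>, hence their join, and \<open>d y x = 0\<close>
  for every \<open>x\<close> in that join. For \<open>x \<in> Z\<close> the choice \<open>d = (y x)\<^sup>*\<close> gives \<open>y x = 0\<close>.
\<close>

lemma ideal_Int_ann_join:
  assumes Z: "annihilator_ideal Z" and Q: "Q \<in> annihilators" and R: "R \<in> annihilators"
  shows "Z \<inter> ann_join Q R = ann_join (Z \<inter> Q) (Z \<inter> R)"
proof
  have Z': "Z \<in> annihilators" and ideal: "\<And>z w. z \<in> Z \<Longrightarrow> w * z \<in> Z \<and> z * w \<in> Z"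
    using Z by (auto simp: annihilator_ideal_def)
  note starZ = star_in_annihilator[OF Z'] and starQ = star_in_annihilator[OF Q]
    and starR = star_in_annihilator[OF R]
  note QR = ann_join_least[OF Q R]
  show "ann_join (Z \<inter> Q) (Z \<inter> R) \<subseteq> Z \<inter> ann_join Q R"
    using QR by (intro ann_join_least(4) Int_in_annihilators Z' Q R) auto
  define S where "S = (Z \<inter> Q) \<union> (Z \<inter> R)"
  have starS: "star s \<in> S" if "s \<in> S" for s
    using that starZ starQ starR by (auto simp: S_def)
  have annS: "v \<in> ann S \<longleftrightarrow> (\<forall>s\<in>S. s * v = 0 \<and> v * s = 0)" for v
    by (rule mem_ann_iff) (rule starS)
  have "y * x = 0" if y: "y \<in> ann S" and x: "x \<in> Z" "x \<in> ann_join Q R" for x y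
  proof -
    have yqd: "y * q * d = 0" if q: "q \<in> Q \<union> R" and d: "d \<in> Z" for q d
    proof -
      have "q * (d * star d) * star q \<in> S"
        using q ideal[OF d] ideal starQ[of q] starR[of q]
          annihilator_hereditary[OF Q, of q "star q" "d * star d"]
          annihilator_hereditary[OF R, of q "star q" "d * star d"]
        unfolding S_def by blast
      then have "y * (q * (d * star d) * star q) = 0"
        using y unfolding annS by blast
      moreover have "(y * q * d) * star (y * q * d) = y * (q * (d * star d) * star q) * star y"
        by (simp add: star_mult mult.assoc)
      ultimately have "(y * q * d) * star (y * q * d) = 0"
        by simp
      then show ?thesis
        by (simp add: mult_star_eq_zero_iff)
    qed
    have dyq: "d * y * q = 0" if q: "q \<in> Q \<union> R" and d: "d \<in> Z" for q d
    proof -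
      let ?e = "d * y * q"
      have "star ?e * ?e \<in> Z"
        using ideal[OF d] ideal by blast
      from yqd[OF q this] have "d * (y * q * (star ?e * ?e)) = 0"
        by simp
      then have "?e * (star ?e * ?e) = 0"
        by (simp only: mult.assoc)
      then show ?thesis
        by (simp only: mult_star_mult_eq_zero_iff)
    qed
    have dyx: "d * y * x = 0" if d: "d \<in> Z" for d
    proof -
      let ?w = "star (d * y) * (d * y)"
      have "?w * q = 0" if "q \<in> Q \<union> R" for q
        using dyq[OF that d] by (simp add: mult.assoc)
      moreover have "q * ?w = 0" if "q \<in> Q \<union> R" for q
      proof -
        have "star q \<in> Q \<union> R"
          using that starQ starR by blast
        then have "star (d * y * star q) = 0"
          using dyq d by (simp add: star_zero)
        moreover have "q * ?w = star (d * y * star q) * (d * y)"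
          by (simp add: star_mult star_star mult.assoc)
        ultimately show ?thesis
          by simp
      qed
      ultimately have "?w \<in> ann (Q \<union> R)"
        by (subst mem_ann_iff) (use starQ starR in blast)+
      then have "?w * x = 0"
        using x(2) mem_ann_iff[of "ann (Q \<union> R)" x] star_in_ann[of _ "Q \<union> R"]
        unfolding ann_join_def by blast
      then show ?thesis
        by (simp only: star_mult_self_mult_eq_zero_iff)
    qed
    have "star (y * x) \<in> Z"
      using ideal[OF x(1)] star_in_annihilator[OF Z'] by blast
    from dyx[OF this] show ?thesis
      by (simp add: mult.assoc star_mult_eq_zero_iff)
  qed
  then show "Z \<inter> ann_join Q R \<subseteq> ann_join (Z \<inter> Q) (Z \<inter> R)"
    using star_in_annihilator[OF Z'] star_in_annihilator[OF QR(1)]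
    by (auto simp: ann_join_def[of "Z \<inter> Q"] ann_def[of "ann _"] perp_def S_def)
qed

text \<open>
  Let \<open>y\<close> annihilate both parts and let \<open>x \<in> X\<close>. For \<open>d\<close> in \<open>Z\<close> or \<open>Z\<^sup>\<bottom>\<close> the element \<open>x d d\<^sup>* x\<^sup>*\<close> lies in
  one of the parts, so \<open>y x d = 0\<close>. Hence \<open>(y x)\<^sup>* (y x)\<close> annihilates \<open>Z\<close> and \<open>Z\<^sup>\<bottom>\<close>, which
  leaves only zero.
\<close>

lemma ann_join_ideal_decomposition:
  assumes Z: "annihilator_ideal Z" and X: "X \<in> annihilators"
  shows "X \<subseteq> ann_join (X \<inter> Z) (X \<inter> ann Z)"
proof -
  have Z': "Z \<in> annihilators" and ideal: "\<And>z w. z \<in> Z \<Longrightarrow> w * z \<in> Z \<and> z * w \<in> Z"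
    and ideal': "\<And>z w. z \<in> ann Z \<Longrightarrow> w * z \<in> ann Z \<and> z * w \<in> ann Z"
    using Z annihilator_ideal_ann[OF Z] by (auto simp: annihilator_ideal_def)
  define S where "S = (X \<inter> Z) \<union> (X \<inter> ann Z)"
  have starS: "star s \<in> S" if "s \<in> S" for s
    using that star_in_annihilator[OF Z'] star_in_annihilator[OF X] star_in_ann by (auto simp: S_def)
  have annS: "v \<in> ann S \<longleftrightarrow> (\<forall>s\<in>S. s * v = 0 \<and> v * s = 0)" for v
    by (rule mem_ann_iff) (rule starS)
  have "y * x = 0" if y: "y \<in> ann S" and x: "x \<in> X" for x y
  proof -
    have yxd: "y * x * d = 0" if d: "d \<in> Z \<union> ann Z" for d
    proof -
      have "x * (d * star d) * star x \<in> S"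
        using x d ideal ideal' annihilator_hereditary[OF X x, of "star x" "d * star d"]
          star_in_annihilator[OF X x]
        unfolding S_def by blast
      then have "y * (x * (d * star d) * star x) = 0"
        using y unfolding annS by blast
      moreover have "(y * x * d) * star (y * x * d) = y * (x * (d * star d) * star x) * star y"
        by (simp add: star_mult mult.assoc)
      ultimately have "(y * x * d) * star (y * x * d) = 0"
        by simp
      then show ?thesis
        by (simp add: mult_star_eq_zero_iff)
    qed
    let ?w = "star (y * x) * (y * x)"
    have wd: "?w * d = 0" if "d \<in> Z \<union> ann Z" for d
      using yxd[OF that] by (simp add: mult.assoc)
    have dw: "d * ?w = 0" if "d \<in> Z \<union> ann Z" for d
    proof -
      have "star d \<in> Z \<union> ann Z"
        using that star_in_annihilator[OF Z'] star_in_ann by blast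
      then have "star (y * x * star d) = 0"
        using yxd by (simp add: star_zero)
      moreover have "d * ?w = star (y * x * star d) * (y * x)"
        by (simp add: star_mult star_star mult.assoc)
      ultimately show ?thesis
        by simp
    qed
    have "?w \<in> ann Z"
      by (subst mem_ann_iff) (use star_in_annihilator[OF Z'] wd dw in blast)+
    moreover have "?w \<in> Z"
      by (rule annihilator_memI[OF Z']) (use wd dw in blast)
    ultimately have "?w = 0"
      using Int_ann[OF Z'] by blast
    then show ?thesis
      by (simp only: star_mult_eq_zero_iff)
  qed
  then show ?thesis
    using star_in_annihilator[OF X]
    by (auto simp: ann_join_def ann_def[of "ann _"] perp_def S_def)
qed

text \<open>
  The left hand side is the join of its parts in \<open>Z\<close> and in \<open>Z\<^sup>\<bottom>\<close>, and in the second part \<open>Z\<close> can be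
  dropped from the join \<open>Z \<or> R\<close> because \<open>Z\<^sup>\<bottom>\<close>, too, is an ideal.
\<close>

lemma Int_ann_join_ideal:
  assumes Z: "annihilator_ideal Z" and P: "P \<in> annihilators" and R: "R \<in> annihilators"
  shows "P \<inter> ann_join Z R = ann_join (P \<inter> Z) (P \<inter> R)"
proof
  have Z': "Z \<in> annihilators"
    using Z by (simp add: annihilator_ideal_def)
  note ZR = ann_join_least[OF Z' R]
  note PP = ann_join_least[OF Int_in_annihilators[OF P Z'] Int_in_annihilators[OF P R]]
  show "ann_join (P \<inter> Z) (P \<inter> R) \<subseteq> P \<inter> ann_join Z R"
    using ZR by (intro PP(4) Int_in_annihilators P) auto
  define X where "X = P \<inter> ann_join Z R"
  have X: "X \<in> annihilators"
    unfolding X_def by (intro Int_in_annihilators P ZR)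
  have "ann Z \<inter> ann_join Z R = ann_join (ann Z \<inter> Z) (ann Z \<inter> R)"
    by (intro ideal_Int_ann_join annihilator_ideal_ann Z Z' R)
  also have "\<dots> \<subseteq> R"
  proof (rule ann_join_least(4))
    show "ann Z \<inter> Z \<subseteq> R"
      using Int_ann[OF Z'] Int_ann[OF R] by blast
  qed (auto intro: Int_in_annihilators ann_in_annihilators Z' R)
  finally have "X \<inter> ann Z \<subseteq> P \<inter> R"
    by (auto simp: X_def)
  moreover have "X \<inter> Z \<subseteq> P \<inter> Z"
    by (auto simp: X_def)
  ultimately have "ann_join (X \<inter> Z) (X \<inter> ann Z) \<subseteq> ann_join (P \<inter> Z) (P \<inter> R)"
    using PP by (intro ann_join_least(4) Int_in_annihilators X Z' ann_in_annihilators) auto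
  then show "P \<inter> ann_join Z R \<subseteq> ann_join (P \<inter> Z) (P \<inter> R)"
    using ann_join_ideal_decomposition[OF Z X] by (auto simp: X_def)
qed

text \<open>
  Meets distribute over joins as soon as one of the three annihilators is an ideal, and within
  \<open>{E, E\<^sup>\<bottom>}\<close> they do so trivially. The dual law is the same law for the orthocomplements.
\<close>

lemma ann_central_ideal:
  fixes D :: "'a::cstar_algebra set"
  assumes D: "annihilator_ideal D"
  shows "ann_central D"
  unfolding ann_central_def
proof (intro conjI ballI)
  show "D \<in> annihilators"
    using D by (simp add: annihilator_ideal_def)
  fix E :: "'a set" assume E: "E \<in> annihilators"
  let ?L = "{D, ann D, E, ann E}"
  have ideal: "annihilator_ideal Z" if "Z \<in> {D, ann D}" for Z
    using that D annihilator_ideal_ann by blast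
  have annih: "P \<in> annihilators" if "P \<in> ?L" for P
    using that \<open>D \<in> annihilators\<close> E ann_in_annihilators by blast
  have ann_L: "ann P \<in> ?L" if "P \<in> ?L" for P
    using that ann_ann[OF E] ann_ann[OF \<open>D \<in> annihilators\<close>] by auto
  have trivial: "P \<inter> ann_join Q R = ann_join (P \<inter> Q) (P \<inter> R)"
    if "P \<in> {E, ann E}" "Q \<in> {E, ann E}" "R \<in> {E, ann E}" for P Q R
  proof -
    have zero: "E \<inter> ann E = {0}" "ann E \<inter> E = {0}"
      using Int_ann[OF E] by blast+
    have bot: "ann {0} = (UNIV :: 'a set)"
      by (auto simp: ann_def perp_def)
    then have top: "ann UNIV = {0 :: 'a}"
      using Int_ann[of UNIV] ann_in_annihilators[of "{0 :: 'a}"] by simp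
    show ?thesis
      using that by (elim insertE emptyE) (simp_all add: ann_join_eq ann_ann[OF E] zero bot top)
  qed
  have L: "?L = {D, ann D} \<union> {E, ann E}"
    by blast
  have meet: "P \<inter> ann_join Q R = ann_join (P \<inter> Q) (P \<inter> R)"
    if PQR: "P \<in> ?L" "Q \<in> ?L" "R \<in> ?L" for P Q R
  proof -
    consider "P \<in> {D, ann D}" | "Q \<in> {D, ann D}" | "R \<in> {D, ann D}"
      | "P \<in> {E, ann E}" "Q \<in> {E, ann E}" "R \<in> {E, ann E}"
      using PQR unfolding L Un_iff by meson
    then show ?thesis
    proof cases
      case 1
      then show ?thesis
        by (intro ideal_Int_ann_join ideal annih PQR)
    next
      case 2
      then show ?thesis
        by (intro Int_ann_join_ideal ideal annih PQR)
    next
      case 3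
      then show ?thesis
        using Int_ann_join_ideal[of R P Q] ideal annih PQR by (simp only: ann_join_commute)
    next
      case 4
      then show ?thesis
        by (rule trivial)
    qed
  qed
  have join: "ann_join P (Q \<inter> R) = ann_join P Q \<inter> ann_join P R"
    if "P \<in> ?L" "Q \<in> ?L" "R \<in> ?L" for P Q R
  proof -
    have "ann_join P (Q \<inter> R) = ann (ann P \<inter> ann_join (ann Q) (ann R))"
      by (simp only: ann_join_eq[of P] ann_Int[OF annih[OF that(2)] annih[OF that(3)]])
    also have "\<dots> = ann (ann_join (ann P \<inter> ann Q) (ann P \<inter> ann R))"
      using meet[OF ann_L ann_L ann_L] that by simp
    also have "\<dots> = ann_join P Q \<inter> ann_join P R"
      by (simp only: ann_ann_join ann_join_eq[of P])
    finally show ?thesis .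
  qed
  show "ann_commute D E"
    unfolding ann_commute_def by (intro ballI conjI meet join)
qed

text \<open>
  The elements \<open>d\<close> with \<open>B A d = 0 = B A d\<^sup>*\<close> form a two-sided ideal because the middle factor absorbs
  whatever \<open>d\<close> is multiplied with from the left. This annihilator separates \<open>C\<close> from \<open>B\<close>.
\<close>

lemma annihilator_ideal_separation:
  fixes B C :: "'a::cstar_algebra set"
  assumes B: "\<And>b. b \<in> B \<Longrightarrow> star b \<in> B" and C: "\<And>c. c \<in> C \<Longrightarrow> star c \<in> C"
    and CB: "\<And>c x b. c \<in> C \<Longrightarrow> b \<in> B \<Longrightarrow> c * x * b = 0"
  obtains D where "annihilator_ideal D" "C \<subseteq> D" "B \<subseteq> ann D"
proof
  define D where "D = ann {b * x | b x. b \<in> B}"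
  have mem: "d \<in> D \<longleftrightarrow> (\<forall>b\<in>B. \<forall>x. b * x * d = 0 \<and> b * x * star d = 0)" for d
    by (auto simp: D_def ann_def perp_def)
  have rev: "d * x * b = 0" if "d \<in> D" "b \<in> B" for d x b
  proof -
    have "star b * star x * star d = 0"
      using that B mem by blast
    then have "star (d * x * b) = 0"
      by (simp add: star_mult mult.assoc)
    then show ?thesis
      by (simp add: star_eq_zero_iff)
  qed
  show ideal: "annihilator_ideal D"
    unfolding annihilator_ideal_def
  proof (intro conjI ballI allI)
    show "D \<in> annihilators"
      by (simp add: D_def ann_in_annihilators)
    fix d w assume "d \<in> D"
    then have zero: "b * x * d = 0" "b * x * star d = 0" if "b \<in> B" for b x
      using that by (auto simp: mem)
    have "b * x * (w * d) = 0 \<and> b * x * star (w * d) = 0" if "b \<in> B" for b x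
      using zero(1)[OF that, of "x * w"] zero(2)[OF that, of x]
      by (simp add: star_mult flip: mult.assoc)
    then show "w * d \<in> D"
      by (simp add: mem)
    have "b * x * (d * w) = 0 \<and> b * x * star (d * w) = 0" if "b \<in> B" for b x
      using zero(1)[OF that, of x] zero(2)[OF that, of "x * star w"]
      by (simp add: star_mult flip: mult.assoc)
    then show "d * w \<in> D"
      by (simp add: mem)
  qed
  show "C \<subseteq> D"
  proof
    fix c assume c: "c \<in> C"
    have "b * x * c' = 0" if "b \<in> B" "c' \<in> C" for b x c'
    proof -
      have "star c' * star x * star b = 0"
        using that B C CB by blast
      then have "star (b * x * c') = 0"
        by (simp add: star_mult mult.assoc)
      then show ?thesis
        by (simp add: star_eq_zero_iff)
    qed
    then show "c \<in> D"
      using c C by (auto simp: mem)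
  qed
  show "B \<subseteq> ann D"
  proof
    fix b assume b: "b \<in> B"
    have "d * b' = 0" if d: "d \<in> D" and b': "b' \<in> B" for d b'
    proof -
      have "d * (b' * star b' * star d * d) * b' = 0"
        by (rule rev[OF d b'])
      then have "d * b' * (star (d * b') * (d * b')) = 0"
        by (simp add: star_mult mult.assoc)
      then show ?thesis
        by (simp only: mult_star_mult_eq_zero_iff)
    qed
    then show "b \<in> ann D"
      using b B by (auto simp: ann_def perp_def)
  qed
qed

section \<open>Comparison of annihilators\<close>

text \<open>
  Multiplying \<open>\<Sum> c\<^sub>n f\<^sub>n\<close> from the left by \<open>f\<^sub>m\<^sup>*\<close> isolates the \<open>m\<close>-th term.
\<close>

lemma orthogonal_sum_mult_eq_zero_iff:
  fixes f :: "nat \<Rightarrow> 'a::cstar_algebra"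
  assumes orth: "\<And>m n. m \<noteq> n \<Longrightarrow> star (f m) * f n = 0"
    and c: "\<And>n. 0 < c n" and a: "(\<lambda>n. c n *\<^sub>R f n) sums a"
  shows "a * x = 0 \<longleftrightarrow> (\<forall>n. f n * x = 0)"
proof
  assume ax: "a * x = 0"
  show "\<forall>n. f n * x = 0"
  proof
    fix m
    have "(\<lambda>n. star (f m) * (c n *\<^sub>R f n)) sums (star (f m) * a)"
      by (rule bounded_linear.sums[OF bounded_linear_mult_right a])
    moreover have "(\<lambda>n. star (f m) * (c n *\<^sub>R f n)) sums
        (\<Sum>n\<in>{m}. star (f m) * (c n *\<^sub>R f n))"
      by (rule sums_finite) (simp_all add: orth)
    ultimately have "star (f m) * a = (\<Sum>n\<in>{m}. star (f m) * (c n *\<^sub>R f n))"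
      by (rule sums_unique2)
    then have eq: "star (f m) * a = c m *\<^sub>R (star (f m) * f m)"
      by simp
    have "star (f m) * a * x = 0"
      by (simp add: mult.assoc ax)
    then have "c m *\<^sub>R (star (f m) * f m * x) = 0"
      by (simp add: eq)
    then have "star (f m) * f m * x = 0"
      using c[of m] by simp
    then show "f m * x = 0"
      by (simp only: star_mult_self_mult_eq_zero_iff)
  qed
next
  assume "\<forall>n. f n * x = 0"
  then have "(\<lambda>n. 0) sums (a * x)"
    using bounded_linear.sums[OF bounded_linear_mult_left a, of x] by simp
  then show "a * x = 0"
    using sums_unique2 sums_zero by blast
qed

text \<open>
  Nonzero elements are enumerated once only, so that orthogonality of distinct elements becomes
  orthogonality for distinct indices.
\<close>

lemma countable_enumeration_padded:
  assumes "countable M"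
  obtains f :: "nat \<Rightarrow> 'a::zero" where "M \<subseteq> range f" "range f \<subseteq> insert 0 M"
    "\<And>i j. f i = f j \<Longrightarrow> i = j \<or> f i = 0"
proof
  define f where "f n = (if n \<in> to_nat_on M ` M then from_nat_into M n else 0)" for n
  have f: "f (to_nat_on M a) = a" if "a \<in> M" for a
    using that assms by (simp add: f_def)
  then show "M \<subseteq> range f"
    by (metis rangeI subsetI)
  show "range f \<subseteq> insert 0 M"
    using assms by (auto simp: f_def)
  show "i = j \<or> f i = 0" if "f i = f j" for i j
    using that assms by (auto simp: f_def split: if_splits)
qed

text \<open>
  An inclusion of \<open>B\<^sup>\<bottom>\<close> in \<open>{a}\<^sup>\<bottom>\<close> says that the right support of \<open>a\<close> lies in \<open>B\<close>, and \<open>{a\<^sup>*}\<^sup>\<bottom>\<close>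
  describes the left support in the same way. The element is the weighted sum of a maximal family
  of nonzero \<open>a\<^sub>i\<close> with right support in \<open>B\<close>, left support in \<open>C\<close> and \<open>a\<^sub>i\<^sup>* a\<^sub>j = 0 = a\<^sub>i a\<^sub>j\<^sup>*\<close> for
  \<open>i \<noteq> j\<close>. The positive elements \<open>a\<^sub>i\<^sup>* a\<^sub>i\<close> are pairwise orthogonal, so the family is countable. A nonzero
  product \<open>c x b\<close> as in the conclusion could be added to it.
\<close>

lemma exists_maximal_partial_equivalence:
  fixes B C :: "'a::cstar_algebra set"
  assumes sep: "orthoseparable TYPE('a)"
    and B: "B \<in> annihilators" and C: "C \<in> annihilators"
  obtains a where "ann B \<subseteq> ann {a}" "ann C \<subseteq> ann {star a}"
    "\<And>c x b. c \<in> C \<inter> ann {star a} \<Longrightarrow> b \<in> B \<inter> ann {a} \<Longrightarrow> c * x * b = 0"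
proof -
  define F where "F = {a. a \<noteq> 0 \<and> ann B \<subseteq> ann {a} \<and> ann C \<subseteq> ann {star a}}"
  define \<M> where
    "\<M> = {M. M \<subseteq> F \<and> pairwise (\<lambda>a b. star a * b = 0 \<and> a * star b = 0) M}"
  have "\<exists>M\<in>\<M>. \<forall>X\<in>\<M>. M \<subseteq> X \<longrightarrow> X = M"
  proof (rule subset_Zorn')
    fix \<C> assume chain: "subset.chain \<M> \<C>"
    then have "\<Union>\<C> \<subseteq> F"
      by (auto simp: subset.chain_def \<M>_def)
    moreover have "pairwise (\<lambda>a b. star a * b = 0 \<and> a * star b = 0) (\<Union>\<C>)"
    proof (rule pairwiseI)
      fix a b assume "a \<in> \<Union>\<C>" "b \<in> \<Union>\<C>" "a \<noteq> b"
      moreover from this obtain M where "M \<in> \<C>" "a \<in> M" "b \<in> M"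
        using chain unfolding subset_chain_def by blast
      ultimately show "star a * b = 0 \<and> a * star b = 0"
        using chain by (auto simp: subset.chain_def \<M>_def pairwise_def)
    qed
    ultimately show "\<Union>\<C> \<in> \<M>"
      by (simp add: \<M>_def)
  qed
  then obtain M where M: "M \<in> \<M>" and max: "\<And>X. X \<in> \<M> \<Longrightarrow> M \<subseteq> X \<Longrightarrow> X = M"
    by blast
  have MF: "M \<subseteq> F"
    and orth: "\<And>a b. a \<in> M \<Longrightarrow> b \<in> M \<Longrightarrow> a \<noteq> b \<Longrightarrow> star a * b = 0 \<and> a * star b = 0"
    using M by (auto simp: \<M>_def pairwise_def)
  have "countable M"
  proof -
    have sq: "(star a * a) * (star b * b) = 0" if "a \<in> M" "b \<in> M" "a \<noteq> b" for a b
      using orth[OF that] by (metis mult.assoc mult_zero_left mult_zero_right)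
    have "perp (star a * a) (star b * b)" if "a \<in> M" "b \<in> M" "a \<noteq> b" for a b
      using sq[OF that] by (simp add: perp_def star_mult star_star)
    then have "pairwise perp ((\<lambda>a. star a * a) ` M)"
      unfolding pairwise_def by blast
    moreover have "(\<lambda>a. star a * a) ` M \<subseteq> positive_elements"
      by (auto simp: positive_elements_def)
    ultimately have "countable ((\<lambda>a. star a * a) ` M)"
      using sep by (simp add: orthoseparable_def)
    moreover have "inj_on (\<lambda>a. star a * a) M"
    proof (rule inj_onI, rule ccontr)
      fix a b assume ab: "a \<in> M" "b \<in> M" "star a * a = star b * b" "a \<noteq> b"
      then have "star a * a * (star a * a) = 0"
        using sq by metis
      then have "a = 0"
        by (metis star_mult_self_mult_eq_zero_iff mult_star_mult_eq_zero_iff)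
      then show False
        using ab(1) MF by (auto simp: F_def)
    qed
    ultimately show ?thesis
      by (rule countable_image_inj_on)
  qed
  then obtain f :: "nat \<Rightarrow> 'a" where f: "M \<subseteq> range f" "range f \<subseteq> insert 0 M"
    "\<And>i j. f i = f j \<Longrightarrow> i = j \<or> f i = 0"
    by (rule countable_enumeration_padded) blast
  have forth: "star (f m) * f n = 0 \<and> f m * star (f n) = 0" if "m \<noteq> n" for m n
  proof (cases "f m = 0 \<or> f n = 0")
    case False
    then show ?thesis
      using orth[of "f m" "f n"] f(2,3) that by blast
  qed (auto simp: star_zero)
  have fB: "ann B \<subseteq> ann {f n}" and fC: "ann C \<subseteq> ann {star (f n)}" for n
  proof -
    have "f n = 0 \<or> f n \<in> F"
      using f(2) MF by blast
    then show "ann B \<subseteq> ann {f n}" "ann C \<subseteq> ann {star (f n)}"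
      by (auto simp: F_def mem_ann_singleton_iff star_zero)
  qed
  obtain w where w: "\<And>n. 0 < w n" and sum: "summable (\<lambda>n. w n *\<^sub>R f n)"
    by (rule summable_positive_weights[of f]) (rule that)
  define a where "a = (\<Sum>n. w n *\<^sub>R f n)"
  have a: "(\<lambda>n. w n *\<^sub>R f n) sums a"
    unfolding a_def by (rule summable_sums[OF sum])
  have a': "(\<lambda>n. w n *\<^sub>R star (f n)) sums star a"
    using bounded_linear.sums[OF bounded_linear_star a] by (simp add: star_scaleR)
  have ax: "a * x = 0 \<longleftrightarrow> (\<forall>n. f n * x = 0)" for x
    by (rule orthogonal_sum_mult_eq_zero_iff[OF _ w a]) (use forth in blast)
  have a'x: "star a * x = 0 \<longleftrightarrow> (\<forall>n. star (f n) * x = 0)" for x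
    by (rule orthogonal_sum_mult_eq_zero_iff[OF _ w a']) (use forth star_star in metis)
  show thesis
  proof
    show "ann B \<subseteq> ann {a}" "ann C \<subseteq> ann {star a}"
      using fB fC by (auto simp: mem_ann_singleton_iff ax a'x subset_iff)
    fix c x b assume c: "c \<in> C \<inter> ann {star a}" and b: "b \<in> B \<inter> ann {a}"
    define d where "d = c * x * b"
    have fd: "star (f n) * d = 0" for n
      using c by (simp add: d_def mem_ann_singleton_iff a'x flip: mult.assoc)
    have df: "d * star (f n) = 0" for n
    proof -
      have "star (f n * star b) = 0"
        using b by (simp add: mem_ann_singleton_iff ax star_zero)
      then show ?thesis
        by (simp add: d_def star_mult star_star mult.assoc)
    qed
    show "c * x * b = 0"
    proof (rule ccontr)
      assume "c * x * b \<noteq> 0"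
      then have d0: "d \<noteq> 0"
        by (simp add: d_def)
      have "d * y = 0" if "y \<in> ann B" for y
        using ann_mult_eq_zero[OF B _ that] b by (simp add: d_def mult.assoc)
      moreover have "star d * y = 0" if "y \<in> ann C" for y
        using ann_mult_eq_zero[OF C star_in_annihilator[OF C] that] c
        by (simp add: d_def star_mult mult.assoc)
      ultimately have "d \<in> F"
        using d0 by (auto simp: F_def mem_ann_singleton_iff star_in_ann)
      moreover have "star d * m = 0 \<and> star m * d = 0 \<and> d * star m = 0 \<and> m * star d = 0"
        if mM: "m \<in> M" for m
      proof -
        obtain n where m: "m = f n"
          using f(1) mM by blast
        have "star d * f n = star (star (f n) * d)" "f n * star d = star (d * star (f n))"
          by (simp_all only: star_mult star_star)
        then show ?thesis
          by (simp add: m fd df star_zero)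
      qed
      ultimately have "insert d M \<in> \<M>"
        using M by (auto simp: \<M>_def pairwise_insert)
      then have "d \<in> M"
        using max[of "insert d M"] by blast
      then obtain n where "d = f n"
        using f(1) by blast
      then show False
        using fd[of n] d0 by (simp add: star_mult_eq_zero_iff)
    qed
  qed
qed

text \<open>
  Choose a self-adjoint \<open>g\<close> that generates \<open>B \<inter> D\<close> and put \<open>t = a g\<close>. The left support of \<open>t\<close> lies in
  \<open>C \<inter> D\<close>. If \<open>t x = 0\<close>, then \<open>y = g x\<close> satisfies \<open>y y\<^sup>* \<in> B \<inter> D\<close> and \<open>a y y\<^sup>* = 0\<close>, so
  \<open>y y\<^sup>* \<in> D \<inter> D\<^sup>\<bottom> = {0}\<close>: hence \<open>t\<close> has the same right support as \<open>g\<close>, namely all of \<open>B \<inter> D\<close>,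
  also when \<open>B \<inter> D\<close> is not contained in the right support of \<open>a\<close>.
\<close>

lemma subequiv_on_ideal:
  fixes B C D :: "'a::cstar_algebra set"
  assumes sep: "anniseparable TYPE('a)"
    and B: "B \<in> annihilators" and C: "C \<in> annihilators" and D: "annihilator_ideal D"
    and aB: "ann B \<subseteq> ann {a}" and aC: "ann C \<subseteq> ann {star a}"
    and rest: "B \<inter> ann {a} \<subseteq> ann D"
  shows "B \<inter> D \<lesssim>\<^sub>a C \<inter> D"
proof -
  have D': "D \<in> annihilators" and ideal: "\<And>z w. z \<in> D \<Longrightarrow> w * z \<in> D \<and> z * w \<in> D"
    using D by (auto simp: annihilator_ideal_def)
  have BD: "B \<inter> D \<in> annihilators" and CD: "C \<inter> D \<in> annihilators"
    by (intro Int_in_annihilators B C D')+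
  obtain g where g: "star g = g" "ann {g} = ann (B \<inter> D)"
    using ann_eq_ann_singleton[OF sep BD] by blast
  have gBD: "ann (ann {g}) = B \<inter> D"
    by (simp add: g(2) ann_ann[OF BD])
  have "{g} \<subseteq> ann (ann {g})"
    by (rule subset_ann_ann) (simp add: g(1))
  then have gmem: "g \<in> B" "g \<in> D"
    by (auto simp: gBD)
  define t where "t = a * g"
  have tx: "t * x = 0 \<longleftrightarrow> g * x = 0" for x
  proof
    assume "t * x = 0"
    then have "g * x * star (g * x) \<in> ann {a}"
      by (simp add: mem_ann_singleton_iff star_mult star_star t_def) (metis mult.assoc mult_zero_left)
    moreover have "g * (x * star x) * g \<in> B \<inter> D"
      using annihilator_hereditary[OF BD, of g g] gmem by blast
    then have "g * x * star (g * x) \<in> B \<inter> D"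
      by (simp add: star_mult g(1) mult.assoc)
    ultimately have "g * x * star (g * x) \<in> D \<inter> ann D"
      using rest by blast
    then show "g * x = 0"
      using Int_ann[OF D'] by (simp add: mult_star_eq_zero_iff)
  qed (simp add: t_def mult.assoc)
  have "ann {t} = ann {g}"
    by (auto simp: mem_ann_singleton_iff tx)
  then have t_BD: "ann (ann {t}) = B \<inter> D"
    by (simp add: gBD)
  have "t * star t \<in> C"
  proof (rule annihilator_memI[OF C])
    fix y assume y: "y \<in> ann C"
    have ay: "star a * y = 0" "star a * star y = 0"
      using aC y by (auto simp: mem_ann_singleton_iff)
    have "y * a = star (star a * star y)"
      by (simp only: star_mult star_star)
    then have ya: "y * a = 0"
      by (simp add: ay star_zero)
    have "y * (t * star t) = y * a * (g * star t)" "t * star t * y = t * star g * (star a * y)"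
      by (simp_all add: t_def star_mult mult.assoc)
    then show "y * (t * star t) = 0 \<and> t * star t * y = 0"
      by (simp add: ya ay)
  qed
  moreover have "t * star t \<in> D"
    using gmem(2) ideal t_def by blast
  ultimately have tt: "t * star t \<in> C \<inter> D"
    by blast
  have "star t * y = 0" if "y \<in> ann (C \<inter> D)" for y
  proof -
    have "star (star t) * star t * y = 0"
      using ann_mult_eq_zero[OF CD tt that] by (simp add: star_star)
    then show ?thesis
      by (simp only: star_mult_self_mult_eq_zero_iff)
  qed
  then have "ann (C \<inter> D) \<subseteq> ann {star t}"
    by (auto simp: mem_ann_singleton_iff star_in_ann)
  then have "ann (ann {star t}) \<subseteq> C \<inter> D"
    using ann_antimono ann_ann[OF CD] by blast
  then show ?thesis
    using t_BD ann_in_annihilators by (auto simp: ann_subequiv_def ann_equiv_def)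
qed

theorem theorem3p47:
  fixes B C :: "'a::cstar_algebra set"
  assumes "anniseparable TYPE('a)"
    and "orthoseparable TYPE('a)"
    and "B \<in> annihilators"
    and "C \<in> annihilators"
  shows "\<exists>D. ann_central D \<and> B \<inter> D \<lesssim>\<^sub>a C \<inter> D \<and> C \<inter> ann D \<lesssim>\<^sub>a B \<inter> ann D"
proof -
  obtain a where a: "ann B \<subseteq> ann {a}" "ann C \<subseteq> ann {star a}"
    and orth: "\<And>c x b. c \<in> C \<inter> ann {star a} \<Longrightarrow> b \<in> B \<inter> ann {a} \<Longrightarrow> c * x * b = 0"
    using exists_maximal_partial_equivalence[OF assms(2-4)] by blast
  obtain D where D: "annihilator_ideal D" "C \<inter> ann {star a} \<subseteq> D" "B \<inter> ann {a} \<subseteq> ann D"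
  proof (rule annihilator_ideal_separation[of "B \<inter> ann {a}" "C \<inter> ann {star a}"])
    show "star b \<in> B \<inter> ann {a}" if "b \<in> B \<inter> ann {a}" for b
      using that star_in_annihilator[OF assms(3)] star_in_ann by blast
    show "star c \<in> C \<inter> ann {star a}" if "c \<in> C \<inter> ann {star a}" for c
      using that star_in_annihilator[OF assms(4)] star_in_ann by blast
  qed (use orth in auto)
  have "ann (ann D) = D"
    using D(1) ann_ann by (auto simp: annihilator_ideal_def)
  then have "C \<inter> ann D \<lesssim>\<^sub>a B \<inter> ann D"
    using a D(2)
    by (intro subequiv_on_ideal[where a = "star a"] assms annihilator_ideal_ann D(1))
       (simp_all add: star_star)
  moreover have "B \<inter> D \<lesssim>\<^sub>a C \<inter> D"
    using a D by (intro subequiv_on_ideal[where a = a] assms)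
  ultimately show ?thesis
    using ann_central_ideal[OF D(1)] by blast
qed

end
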